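(* Let $n$ be a positive even integer and let $N_n=(n-1)(n-3)\cdots3\cdot1$. The procedure EncMap is well defined on every input $m\in\{1,\dots,N_n\}$ (in each iteration the indices $j$ and $i$ to be selected exist), and it gives a bijection from $\{1,2,\dots,N_n\}$ onto the set $\Omega_n$ of pure involution matrices. Moreover, its time complexity is $O(n^2)$, under the assumption that each basic arithmetic operation on (big) integers takes unit time.
   Context: $\Pi_n$ is the set of $n\times n$ permutation matrices and $\Omega_n=\{X\in\Pi_n : X=X^T,\ \operatorname{trace}(X)=0\}$ is the set of pure involutions. EncMap, on input $m\in\{1,\dots,N_n\}$, is the following procedure. (1) Replace $m$ by $m-1$. For $p=0,1,\dots,n/2-1$ in this order: set $a_p:=(m\bmod(2p+1))+1$ and then replace $m$ by $\lfloor m/(2p+1)\rfloor$. (2) Set $X_{i,j}:=0$ for all $i,j\in\{1,\dots,n\}$; set $Z_{i,j}:=1$ for all $i\ne j$ and $Z_{i,i}:=0$ for all $i$. (3) For $p=n/2-1,n/2-2,\dots,0$ in this order: let $j$ be the smallest $j'\in\{1,\dots,n\}$ with $\sum_{i'=1}^nZ_{i',j'}>0$; let $i$ be the smallest $k\in\{1,\dots,n\}$ with $\sum_{i'=1}^kZ_{i',j}=a_p$; set $X_{i,j}:=1$ and $X_{j,i}:=1$; and for all $q\in\{1,\dots,n\}$ set $Z_{q,j}:=0$, $Z_{j,q}:=0$, $Z_{i,q}:=0$, $Z_{q,i}:=0$. (4) Output $X$. *)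

theory Defs
  imports
    "Jordan_Normal_Form.Matrix"
    "HOL-Combinatorics.Permutations"
    "HOL-Library.Landau_Symbols"
begin

section \<open>Pure involutions\<close>

definition perm_mats :: "nat \<Rightarrow> int mat set" where
  "perm_mats n =
     {mat n n (\<lambda>(i, j). if i = \<pi> j then 1 else 0) | \<pi>. \<pi> permutes {..<n}}"

definition mat_trace :: "int mat \<Rightarrow> int" where
  "mat_trace A = (\<Sum>i<dim_row A. A $$ (i, i))"

definition pure_involutions :: "nat \<Rightarrow> int mat set" where
  "pure_involutions n = {X \<in> perm_mats n. X = transpose_mat X \<and> mat_trace X = 0}"

definition num_inputs :: "nat \<Rightarrow> nat" where
  "num_inputs n = (\<Prod>k | k < n \<and> odd k. k)"


section \<open>The procedure EncMap\<close>

text \<open>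
  The working arrays \<open>X\<close> and \<open>Z\<close> are functions of the indices \<open>1, \<dots>, n\<close>; since library
  matrices are indexed from \<open>0\<close>, the indices are shifted when \<open>X\<close> is output.
\<close>

primrec enc_rem :: "nat \<Rightarrow> nat \<Rightarrow> nat" where
  "enc_rem m 0 = m - 1"
| "enc_rem m (Suc p) = enc_rem m p div (2 * p + 1)"

definition enc_digit :: "nat \<Rightarrow> nat \<Rightarrow> nat" where
  "enc_digit m p = enc_rem m p mod (2 * p + 1) + 1"

type_synonym enc_state = "(nat \<Rightarrow> nat \<Rightarrow> int) \<times> (nat \<Rightarrow> nat \<Rightarrow> nat)"

definition enc_init :: enc_state where
  "enc_init = ((\<lambda>i j. 0), (\<lambda>i j. if i = j then 0 else 1))"

definition is_enc_col :: "nat \<Rightarrow> (nat \<Rightarrow> nat \<Rightarrow> nat) \<Rightarrow> nat \<Rightarrow> bool" where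
  "is_enc_col n Z j \<longleftrightarrow> j \<in> {1..n} \<and> (\<Sum>i=1..n. Z i j) > 0"

definition enc_col :: "nat \<Rightarrow> (nat \<Rightarrow> nat \<Rightarrow> nat) \<Rightarrow> nat" where
  "enc_col n Z = (LEAST j. is_enc_col n Z j)"

definition is_enc_row :: "nat \<Rightarrow> (nat \<Rightarrow> nat \<Rightarrow> nat) \<Rightarrow> nat \<Rightarrow> nat \<Rightarrow> nat \<Rightarrow> bool" where
  "is_enc_row n Z j a k \<longleftrightarrow> k \<in> {1..n} \<and> (\<Sum>i=1..k. Z i j) = a"

definition enc_row :: "nat \<Rightarrow> (nat \<Rightarrow> nat \<Rightarrow> nat) \<Rightarrow> nat \<Rightarrow> nat \<Rightarrow> nat" where
  "enc_row n Z j a = (LEAST k. is_enc_row n Z j a k)"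

definition enc_step :: "nat \<Rightarrow> nat \<Rightarrow> enc_state \<Rightarrow> enc_state" where
  "enc_step n a = (\<lambda>(X, Z).
     let j = enc_col n Z; i = enc_row n Z j a
     in (\<lambda>r c. if (r, c) = (i, j) \<or> (r, c) = (j, i) then 1 else X r c,
         \<lambda>r c. if r \<in> {i, j} \<or> c \<in> {i, j} then 0 else Z r c))"

text \<open>
  The loop counter \<open>p\<close> of the main loop runs downwards; in iteration \<open>t = 0, 1, \<dots>\<close> it has the
  value \<open>n / 2 - 1 - t\<close>.
\<close>

definition enc_counter :: "nat \<Rightarrow> nat \<Rightarrow> nat" where
  "enc_counter n t = n div 2 - 1 - t"

primrec enc_state :: "nat \<Rightarrow> nat \<Rightarrow> nat \<Rightarrow> enc_state" where
  "enc_state n m 0 = enc_init"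
| "enc_state n m (Suc t) = enc_step n (enc_digit m (enc_counter n t)) (enc_state n m t)"

definition encmap :: "nat \<Rightarrow> nat \<Rightarrow> int mat" where
  "encmap n m = mat n n (\<lambda>(i, j). fst (enc_state n m (n div 2)) (i + 1) (j + 1))"

definition encmap_well_defined :: "nat \<Rightarrow> nat \<Rightarrow> bool" where
  "encmap_well_defined n m \<longleftrightarrow>
     (\<forall>t < n div 2. let Z = snd (enc_state n m t) in
        (\<exists>j. is_enc_col n Z j) \<and>
        (\<exists>k. is_enc_row n Z (enc_col n Z) (enc_digit m (enc_counter n t)) k))"


section \<open>A unit-cost machine on big integers\<close>

text \<open>
  Programs work on named arrays of integers; a scalar variable is an array with empty index list.
  Every node of an expression (literal, memory access, arithmetic operation or comparison) costs
  one unit of time, and so does every store into memory.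
\<close>

datatype arith = Add | Sub | Mul | Div | Mod
datatype comparison = Le | Less | Neq

fun arith_sem :: "arith \<Rightarrow> int \<Rightarrow> int \<Rightarrow> int" where
  "arith_sem Add x y = x + y"
| "arith_sem Sub x y = x - y"
| "arith_sem Mul x y = x * y"
| "arith_sem Div x y = x div y"
| "arith_sem Mod x y = x mod y"

fun comparison_sem :: "comparison \<Rightarrow> int \<Rightarrow> int \<Rightarrow> bool" where
  "comparison_sem Le x y \<longleftrightarrow> x \<le> y"
| "comparison_sem Less x y \<longleftrightarrow> x < y"
| "comparison_sem Neq x y \<longleftrightarrow> x \<noteq> y"

datatype 'v aexp =
    Lit int
  | Get 'v "'v aexp list"
  | Op arith "'v aexp" "'v aexp"

datatype 'v bexp = Cmp comparison "'v aexp" "'v aexp"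

type_synonym 'v memory = "'v \<Rightarrow> int list \<Rightarrow> int"

fun aval :: "'v aexp \<Rightarrow> 'v memory \<Rightarrow> int" where
  "aval (Lit x) s = x"
| "aval (Get v es) s = s v (map (\<lambda>e. aval e s) es)"
| "aval (Op f e1 e2) s = arith_sem f (aval e1 s) (aval e2 s)"

fun acost :: "'v aexp \<Rightarrow> nat" where
  "acost (Lit x) = 1"
| "acost (Get v es) = 1 + (\<Sum>e\<leftarrow>es. acost e)"
| "acost (Op f e1 e2) = 1 + acost e1 + acost e2"

fun bval :: "'v bexp \<Rightarrow> 'v memory \<Rightarrow> bool" where
  "bval (Cmp r e1 e2) s \<longleftrightarrow> comparison_sem r (aval e1 s) (aval e2 s)"

fun bcost :: "'v bexp \<Rightarrow> nat" where
  "bcost (Cmp r e1 e2) = 1 + acost e1 + acost e2"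

datatype 'v com =
    Put 'v "'v aexp list" "'v aexp"
  | Seq "'v com" "'v com"  (infixr \<open>;;\<close> 60)
  | While "'v bexp" "'v com"

text \<open>\<open>exec c s t s'\<close>: started in memory \<open>s\<close>, the program \<open>c\<close> halts in memory \<open>s'\<close> after time \<open>t\<close>.\<close>

inductive exec :: "'v com \<Rightarrow> 'v memory \<Rightarrow> nat \<Rightarrow> 'v memory \<Rightarrow> bool" where
  exec_Put: "exec (Put v es e) s (1 + (\<Sum>e'\<leftarrow>es. acost e') + acost e)
     (s(v := (s v)(map (\<lambda>e'. aval e' s) es := aval e s)))"
| exec_Seq: "exec c1 s t1 s' \<Longrightarrow> exec c2 s' t2 s'' \<Longrightarrow> exec (c1 ;; c2) s (t1 + t2) s''"
| exec_While_False: "\<not> bval b s \<Longrightarrow> exec (While b c) s (bcost b) s"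
| exec_While_True: "bval b s \<Longrightarrow> exec c s t1 s' \<Longrightarrow> exec (While b c) s' t2 s'' \<Longrightarrow>
     exec (While b c) s (bcost b + t1 + t2) s''"

lemma exec_deterministic:
  "exec c s t s' \<Longrightarrow> exec c s u r' \<Longrightarrow> u = t \<and> r' = s'"
proof (induction arbitrary: u r' rule: exec.induct)
  case (exec_Put v es e s)
  then show ?case by (auto elim: exec.cases)
next
  case (exec_Seq c1 s t1 s' c2 t2 s'')
  from exec_Seq.prems show ?case
    by cases (use exec_Seq.IH in blast)
next
  case (exec_While_False b s c)
  from exec_While_False.prems show ?case
    by cases (use exec_While_False.hyps in auto)
next
  case (exec_While_True b s c t1 s' t2 s'')
  from exec_While_True.prems show ?case
    by cases (use exec_While_True.hyps exec_While_True.IH in blast)+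
qed


section \<open>EncMap as a program\<close>

datatype cell = RN | RM | RP | RI | RJ | RQ | RSum | RA | RX | RZ | RCol

abbreviation Var :: "'v \<Rightarrow> 'v aexp" where "Var v \<equiv> Get v []"
abbreviation Set :: "'v \<Rightarrow> 'v aexp \<Rightarrow> 'v com" where "Set v e \<equiv> Put v [] e"

definition For :: "'v \<Rightarrow> 'v aexp \<Rightarrow> 'v aexp \<Rightarrow> 'v com \<Rightarrow> 'v com" where
  "For v lo hi c = Set v lo ;; While (Cmp Le (Var v) hi) (c ;; Set v (Op Add (Var v) (Lit 1)))"

definition digits_prog :: "cell com" where
  "digits_prog = (let base = Op Add (Op Mul (Lit 2) (Var RP)) (Lit 1) in
     Set RM (Op Sub (Var RM) (Lit 1)) ;;
     For RP (Lit 0) (Op Sub (Op Div (Var RN) (Lit 2)) (Lit 1))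
       (Put RA [Var RP] (Op Add (Op Mod (Var RM) base) (Lit 1)) ;;
        Set RM (Op Div (Var RM) base)))"

text \<open>
  Recomputing every column sum of \<open>Z\<close> in each search for \<open>j\<close> would take cubic time.  The program
  therefore keeps the column sums in the array \<open>RCol\<close> and updates them whenever an entry of \<open>Z\<close>
  is cleared.
\<close>

definition init_prog :: "cell com" where
  "init_prog =
     For RI (Lit 1) (Var RN) (For RJ (Lit 1) (Var RN)
       (Put RX [Var RI, Var RJ] (Lit 0) ;; Put RZ [Var RI, Var RJ] (Lit 1))) ;;
     For RI (Lit 1) (Var RN) (Put RZ [Var RI, Var RI] (Lit 0)) ;;
     For RJ (Lit 1) (Var RN)
       (Put RCol [Var RJ] (Lit 0) ;;
        For RI (Lit 1) (Var RN)
          (Put RCol [Var RJ] (Op Add (Get RCol [Var RJ]) (Get RZ [Var RI, Var RJ]))))"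

definition find_col_prog :: "cell com" where
  "find_col_prog =
     Set RJ (Lit 1) ;;
     While (Cmp Le (Get RCol [Var RJ]) (Lit 0)) (Set RJ (Op Add (Var RJ) (Lit 1)))"

definition find_row_prog :: "cell com" where
  "find_row_prog =
     Set RI (Lit 1) ;;
     Set RSum (Get RZ [Lit 1, Var RJ]) ;;
     While (Cmp Neq (Var RSum) (Get RA [Var RP]))
       (Set RI (Op Add (Var RI) (Lit 1)) ;;
        Set RSum (Op Add (Var RSum) (Get RZ [Var RI, Var RJ])))"

definition clear_prog :: "cell \<Rightarrow> cell \<Rightarrow> cell com" where
  "clear_prog r c =
     Put RCol [Var c] (Op Sub (Get RCol [Var c]) (Get RZ [Var r, Var c])) ;;
     Put RZ [Var r, Var c] (Lit 0)"

definition main_loop_prog :: "cell com" where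
  "main_loop_prog =
     Set RP (Op Sub (Op Div (Var RN) (Lit 2)) (Lit 1)) ;;
     While (Cmp Le (Lit 0) (Var RP))
       (find_col_prog ;;
        find_row_prog ;;
        Put RX [Var RI, Var RJ] (Lit 1) ;;
        Put RX [Var RJ, Var RI] (Lit 1) ;;
        For RQ (Lit 1) (Var RN)
          (clear_prog RQ RJ ;; clear_prog RJ RQ ;; clear_prog RI RQ ;; clear_prog RQ RI) ;;
        Set RP (Op Sub (Var RP) (Lit 1)))"

definition encmap_prog :: "cell com" where
  "encmap_prog = digits_prog ;; init_prog ;; main_loop_prog"

definition output_mat :: "nat \<Rightarrow> cell memory \<Rightarrow> int mat" where
  "output_mat n s = mat n n (\<lambda>(i, j). s RX [int i + 1, int j + 1])"

text \<open>
  \<open>T\<close> bounds the running time on all admissible inputs; all memory cells other than the two inputs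
  have arbitrary initial contents.
\<close>

definition encmap_time_bound :: "(nat \<Rightarrow> nat) \<Rightarrow> bool" where
  "encmap_time_bound T \<longleftrightarrow>
     (\<forall>n m s. n > 0 \<longrightarrow> even n \<longrightarrow> m \<in> {1..num_inputs n} \<longrightarrow> s RN [] = int n \<longrightarrow> s RM [] = int m \<longrightarrow>
        (\<exists>t s'. exec encmap_prog s t s' \<and> output_mat n s' = encmap n m \<and> t \<le> T n))"

end

theory Submission
  imports Defs
begin

text \<open>
  After \<open>t\<close> iterations of the main loop the state is determined by a set \<open>U\<close> of \<open>2 t\<close> indices and
  a fixed-point free involution \<open>\<sigma>\<close> of \<open>U\<close>: \<open>X\<close> is the graph of \<open>\<sigma>\<close>, and \<open>Z\<close> marks the pairs of distinct
  indices outside \<open>U\<close>.  An iteration pairs the least free index \<open>j\<close> with the \<open>a\<close>-th of the other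
  \<open>2 p + 1\<close> free indices, so every \<open>a \<in> {1..2 p + 1}\<close> is admissible, and any prescribed partner of \<open>j\<close>
  is selected by exactly one \<open>a\<close>.  Hence the digits can be read off the output, every involution
  arises from some digits, and the digits are the mixed radix expansion of \<open>m - 1\<close>.

  For the running time, an iteration of the program costs \<open>O(n)\<close> because the two searches and the
  clearing loop each make at most \<open>n\<close> passes; clearing one entry of \<open>Z\<close> together with the
  update of \<open>RCol\<close> keeps the stored column sums correct.
\<close>

section \<open>Mixed radix digits\<close>

text \<open>Reindexing the odd factors as \<open>2 * p + 1\<close> exhibits the number of inputs as
  the product of the radices.\<close>

lemma num_inputs_double: "num_inputs (2 * h) = (\<Prod>p<h. 2 * p + 1)"
proof (induction h)
  case 0
  then show ?case by (simp add: num_inputs_def)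
next
  case (Suc h)
  have "{k. k < 2 * Suc h \<and> odd k} = insert (2 * h + 1) {k. k < 2 * h \<and> odd k}"
    by (auto simp: less_Suc_eq elim: oddE)
  then show ?case using Suc by (simp add: num_inputs_def)
qed

lemma enc_rem_div: "enc_rem m h = (m - 1) div (\<Prod>p<h. 2 * p + 1)"
proof (induction h)
  case (Suc h)
  then show ?case by (simp only: enc_rem.simps prod.lessThan_Suc div_mult2_eq)
qed simp

text \<open>Iterated division is a single division by the product of the radices, so a positive
  input is admissible for \<open>2 * h\<close> exactly when its first \<open>h\<close> digits
  exhaust it.\<close>

lemma enc_rem_eq_0: "enc_rem m h = 0 \<longleftrightarrow> m \<le> num_inputs (2 * h)"
proof -
  have "(m - 1) div P = 0 \<longleftrightarrow> m \<le> P" if "P > 0" for P :: nat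
    using that by (auto simp: div_eq_0_iff)
  moreover have "(\<Prod>p<h. 2 * p + 1) > (0::nat)" by (simp add: prod_pos)
  ultimately show ?thesis
    unfolding enc_rem_div num_inputs_double by blast
qed

lemma enc_digit_bounds: "enc_digit m p \<in> {1..2 * p + 1}"
  by (simp add: enc_digit_def Suc_leI)

lemma enc_rem_Suc_digit: "enc_rem m p = enc_rem m (Suc p) * (2 * p + 1) + (enc_digit m p - 1)"
  by (simp only: enc_rem.simps enc_digit_def add_diff_cancel_right' div_mult_mod_eq)

text \<open>Digits and last quotient allow the divisions to be undone from the top digit down. The
  conclusion compares \<open>enc_rem _ 0\<close>, that is \<open>m - 1\<close>, because truncated
  subtraction identifies the inputs 0 and 1.\<close>

lemma enc_digits_inj:
  assumes "\<forall>p<h. enc_digit m p = enc_digit m' p" "enc_rem m h = enc_rem m' h"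
  shows "enc_rem m 0 = enc_rem m' 0"
  using assms
proof (induction h)
  case (Suc h)
  have "enc_digit m h = enc_digit m' h" using Suc.prems(1) by simp
  then have "enc_rem m h = enc_rem m' h"
    using Suc.prems(2) enc_rem_Suc_digit[of m h] enc_rem_Suc_digit[of m' h] by presburger
  then show ?case using Suc by simp
qed simp

text \<open>The final quotient \<open>q\<close> is kept general so that the induction can fold the
  top digit into it; admissible inputs are the case \<open>q = 0\<close>.\<close>

lemma enc_digits_surj:
  assumes "\<forall>p<h. d p \<in> {1..2 * p + 1}"
  shows "\<exists>m\<ge>1. enc_rem m h = q \<and> (\<forall>p<h. enc_digit m p = d p)"
  using assms
proof (induction h arbitrary: q)
  case 0
  show ?case by (rule exI[of _ "q + 1"]) simp
next
  case (Suc h)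
  \<comment> \<open>The quotient before the last division is rebuilt from \<open>q\<close> and
    \<open>d h\<close>; the \<open>- 1\<close> undoes the offset in
    \<open>enc_digit\<close>.\<close>
  obtain m where m: "m \<ge> 1" "enc_rem m h = q * (2 * h + 1) + (d h - 1)" "\<forall>p<h. enc_digit m p = d p"
    using Suc.IH[of "q * (2 * h + 1) + (d h - 1)"] Suc.prems by auto
  have d: "1 \<le> d h" "d h - 1 < 2 * h + 1" using Suc.prems by force+
  have "enc_rem m (Suc h) = q" "enc_digit m h = d h"
    unfolding enc_rem.simps enc_digit_def m(2) using d
    by (metis div_mult_self3 mod_mult_self3 div_less mod_less add_0_right add.commute
        bot_nat_0.extremum_strict le_add_diff_inverse)+
  then show ?case using m by (auto simp: less_Suc_eq)
qed

section \<open>Partial pairings\<close>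

text \<open>Values of \<open>\<sigma>\<close> outside \<open>U\<close> are unconstrained, so one
  function can serve a growing chain of sets.\<close>

definition pairing :: "'a set \<Rightarrow> ('a \<Rightarrow> 'a) \<Rightarrow> bool" where
  "pairing U \<sigma> \<longleftrightarrow> (\<forall>x\<in>U. \<sigma> x \<in> U \<and> \<sigma> (\<sigma> x) = x \<and> \<sigma> x \<noteq> x)"

text \<open>The shifts pass from indices \<open>1..n\<close> to 0-based matrices. The column is the
  image of the row, opposite to \<open>perm_mats\<close>; for an involution both conventions
  agree.\<close>

definition pairing_mat :: "nat \<Rightarrow> (nat \<Rightarrow> nat) \<Rightarrow> int mat" where
  "pairing_mat n \<sigma> = mat n n (\<lambda>(i, j). if j + 1 = \<sigma> (i + 1) then 1 else 0)"

lemma pairing_extend: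
  assumes "pairing U \<sigma>" "i \<notin> U" "j \<notin> U" "i \<noteq> j"
  shows "pairing (insert i (insert j U)) (\<sigma>(i := j, j := i))"
  using assms unfolding pairing_def by auto

text \<open>The shifted map \<open>\<pi>\<close> is its own inverse, hence a permutation with
  symmetric matrix, and the absence of fixed points clears the diagonal.\<close>

lemma pairing_mat_in_pure_involutions:
  assumes "pairing {1..n} \<sigma>"
  shows "pairing_mat n \<sigma> \<in> pure_involutions n"
proof -
  \<comment> \<open>The second branch is there because \<open>permutes\<close> demands the identity
    outside \<open>{..<n}\<close>.\<close>
  define \<pi> where "\<pi> x = (if x < n then \<sigma> (x + 1) - 1 else x)" for x
  have \<sigma>: "\<sigma> (x + 1) \<in> {1..n}" "\<sigma> (\<sigma> (x + 1)) = x + 1" "\<sigma> (x + 1) \<noteq> x + 1" if "x < n" for x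
    using assms that unfolding pairing_def by force+
  have \<pi>_less: "\<pi> x < n" if "x < n" for x
    using \<sigma>(1)[OF that] that by (auto simp: \<pi>_def)
  have \<pi>_plus: "\<pi> x + 1 = \<sigma> (x + 1)" if "x < n" for x
    using \<sigma>(1)[OF that] that by (auto simp: \<pi>_def)
  have \<pi>\<pi>: "\<pi> (\<pi> x) = x" for x
  proof (cases "x < n")
    case True
    then show ?thesis using \<pi>_plus[OF True] \<pi>_plus[OF \<pi>_less[OF True]] \<sigma>(2)[OF True] by simp
  qed (simp add: \<pi>_def)
  have "\<pi> permutes {..<n}"
    unfolding permutes_def
  proof (intro conjI allI impI)
    show "\<exists>!x. \<pi> x = y" for y using \<pi>\<pi> by metis
  qed (simp add: \<pi>_def)
  moreover have entry: "j + 1 = \<sigma> (i + 1) \<longleftrightarrow> i = \<pi> j" if "i < n" "j < n" for i j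
    using \<pi>_plus[OF that(1)] \<pi>\<pi> by (metis add_right_cancel)
  have "pairing_mat n \<sigma> = mat n n (\<lambda>(i, j). if i = \<pi> j then 1 else 0)"
    unfolding pairing_mat_def by (rule eq_matI) (use entry in auto)
  moreover have "pairing_mat n \<sigma> = transpose_mat (pairing_mat n \<sigma>)"
    unfolding pairing_mat_def
    by (rule eq_matI) (use entry \<pi>\<pi> in \<open>auto simp: transpose_mat_def\<close>)
  moreover have "mat_trace (pairing_mat n \<sigma>) = 0"
    unfolding mat_trace_def pairing_mat_def
    by (rule sum.neutral) (use \<sigma>(3) in \<open>auto dest!: sym[of "Suc _"]\<close>)
  ultimately show ?thesis
    unfolding pure_involutions_def perm_mats_def by blast
qed

text \<open>Symmetry makes \<open>\<pi>\<close> an involution; the diagonal entries are nonnegative,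
  so trace 0 excludes every fixed point.\<close>

lemma pure_involutionsE:
  assumes "A \<in> pure_involutions n"
  obtains \<sigma> where "pairing {1..n} \<sigma>" "A = pairing_mat n \<sigma>"
proof -
  obtain \<pi> where \<pi>: "\<pi> permutes {..<n}" and
    A: "A = mat n n (\<lambda>(i, j). if i = \<pi> j then 1 else 0)"
    and sym: "A = transpose_mat A" and tr: "mat_trace A = 0"
    using assms unfolding pure_involutions_def perm_mats_def by blast
  have \<pi>_less: "\<pi> x < n" if "x < n" for x
    using permutes_in_image[OF \<pi>, of x] that by simp
  have swap: "i = \<pi> j \<longleftrightarrow> j = \<pi> i" if "i < n" "j < n" for i j
  proof -
    have "A $$ (i, j) = A $$ (j, i)"
      using arg_cong[OF sym, of "\<lambda>B. B $$ (i, j)"] that by (simp add: A)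
    then show ?thesis using that by (simp add: A split: if_splits)
  qed
  have "(\<Sum>i<n. if i = \<pi> i then 1 else 0 :: int) = 0"
    using tr unfolding mat_trace_def by (simp add: A)
  then have fix_free: "i \<noteq> \<pi> i" if "i < n" for i
    using that by (subst (asm) sum_nonneg_eq_0_iff) (auto split: if_splits)
  define \<sigma> where "\<sigma> x = \<pi> (x - 1) + 1" for x
  show ?thesis
  proof (rule that)
    show "pairing {1..n} \<sigma>"
      unfolding pairing_def
    proof
      fix x assume "x \<in> {1..n}"
      then have x: "x - 1 < n" "x \<ge> 1" by auto
      show "\<sigma> x \<in> {1..n} \<and> \<sigma> (\<sigma> x) = x \<and> \<sigma> x \<noteq> x"
        using \<pi>_less[OF x(1)] swap[of "\<pi> (x - 1)" "x - 1"] fix_free[OF x(1)] x by (auto simp: \<sigma>_def)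
    qed
    show "A = pairing_mat n \<sigma>"
      unfolding A pairing_mat_def by (rule eq_matI) (use swap in \<open>auto simp: \<sigma>_def\<close>)
  qed
qed

section \<open>The main loop of EncMap\<close>

text \<open>Adjacency matrix of the complete graph on the indices outside \<open>U\<close>.\<close>

definition free_mat :: "nat set \<Rightarrow> nat \<Rightarrow> nat \<Rightarrow> nat" where
  "free_mat U r c = (if r \<noteq> c \<and> r \<notin> U \<and> c \<notin> U then 1 else 0)"

definition pairing_state :: "nat set \<Rightarrow> (nat \<Rightarrow> nat) \<Rightarrow> enc_state" where
  "pairing_state U \<sigma> = ((\<lambda>r c. if r \<in> U \<and> c = \<sigma> r then 1 else 0), free_mat U)"

lemma pairing_state_empty: "pairing_state {} \<sigma> = enc_init"
  by (auto simp: pairing_state_def enc_init_def free_mat_def fun_eq_iff)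

lemma pairing_state_cong: "(\<And>x. x \<in> U \<Longrightarrow> \<sigma> x = \<tau> x) \<Longrightarrow> pairing_state U \<sigma> = pairing_state U \<tau>"
  by (auto simp: pairing_state_def fun_eq_iff)

section \<open>Selecting columns and rows by counting free indices\<close>

text \<open>With partial column sums expressed as cardinalities, the choice of a row becomes a
  choice by rank.\<close>

lemma sum_free_mat:
  "(\<Sum>i=1..k. free_mat U i j) = (if j \<in> U then 0 else card ({1..k} - insert j U))"
proof (cases "j \<in> U")
  case False
  have "(\<Sum>i=1..k. free_mat U i j) = (\<Sum>i\<in>{1..k} - insert j U. 1)"
    by (rule sum.mono_neutral_cong_right) (use False in \<open>auto simp: free_mat_def\<close>)
  then show ?thesis using False by simp
qed (simp add: free_mat_def)

lemma card_free:
  fixes n :: nat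
  assumes "U \<subseteq> {1..n}" "j \<in> {1..n} - U"
  shows "card ({1..n} - insert j U) = n - card U - 1"
proof -
  have "finite U" using assms(1) finite_subset by blast
  then show ?thesis using assms by (subst card_Diff_subset) auto
qed

lemma is_enc_col_free:
  "is_enc_col n (free_mat U) j \<Longrightarrow> j \<in> {1..n} - U"
  unfolding is_enc_col_def sum_free_mat by (auto split: if_splits)

text \<open>At least two indices must be free: the column of a single free index would sum to
  0.\<close>

lemma is_enc_col_enc_col:
  assumes "U \<subseteq> {1..n}" "card U + 1 < n"
  shows "is_enc_col n (free_mat U) (enc_col n (free_mat U))"
proof -
  have "\<not> {1..n} \<subseteq> U"
    using assms card_mono[of U "{1..n}"] finite_subset[OF assms(1)] by auto
  then obtain j where "j \<in> {1..n} - U" by blast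
  then have "is_enc_col n (free_mat U) j"
    using assms card_free[OF assms(1)] unfolding is_enc_col_def sum_free_mat by auto
  then show ?thesis unfolding enc_col_def by (rule LeastI)
qed

text \<open>Discrete intermediate value argument: the prefix sums start at 0, grow by at most 1 per
  row and get at least as far as \<open>a\<close>, so they attain \<open>a\<close>. The least row
  attaining it contributes a 1, hence is free and differs from \<open>j\<close>.\<close>

lemma enc_row_free:
  assumes "U \<subseteq> {1..n}" and j: "j \<in> {1..n} - U" and a: "a \<in> {1..n - card U - 1}"
    and i: "i = enc_row n (free_mat U) j a"
  shows "is_enc_row n (free_mat U) j a i" "i \<in> {1..n} - insert j U"
proof -
  let ?f = "\<lambda>k. \<Sum>i=1..k. free_mat U i j"
  have fn: "a \<le> ?f n"
    using a j unfolding sum_free_mat card_free[OF assms(1) j] by simp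
  \<comment> \<open>The first row reaching \<open>a\<close> cannot overshoot, since its predecessor
    is still below \<open>a\<close>.\<close>
  define k where "k = (LEAST k. a \<le> ?f k)"
  have k: "a \<le> ?f k" "k \<le> n" unfolding k_def using fn by (rule LeastI, rule Least_le)
  have "k \<noteq> 0"
  proof
    assume "k = 0"
    then show False using k(1) a by simp
  qed
  then obtain l where l: "k = Suc l" by (cases k) auto
  have "\<not> a \<le> ?f l" using not_less_Least[of l "\<lambda>k. a \<le> ?f k"] l by (simp add: k_def)
  moreover have "?f k \<le> ?f l + 1" unfolding l by (simp add: free_mat_def)
  ultimately have "is_enc_row n (free_mat U) j a k"
    using k \<open>k \<noteq> 0\<close> unfolding is_enc_row_def by auto
  then show row: "is_enc_row n (free_mat U) j a i"
    unfolding i enc_row_def by (rule LeastI)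
  then have i': "i \<in> {1..n}" "?f i = a" unfolding is_enc_row_def by auto
  have "i \<notin> insert j U"
  proof
    assume "i \<in> insert j U"
    then have "free_mat U i j = 0" by (auto simp: free_mat_def)
    \<comment> \<open>With a zero entry in row \<open>i\<close> the preceding prefix would have the
      same sum, against minimality; \<open>a > 0\<close> keeps that prefix nonempty.\<close>
    moreover obtain l where l: "i = Suc l" using i'(1) by (cases i) auto
    ultimately have "?f l = a" using i'(2) by simp
    moreover from this have "l \<noteq> 0" using a by (cases l) auto
    ultimately have "is_enc_row n (free_mat U) j a l"
      using i' l unfolding is_enc_row_def by auto
    then have "i \<le> l" unfolding i enc_row_def by (rule Least_le)
    then show False using l by simp
  qed
  then show "i \<in> {1..n} - insert j U" using i' by blast
qed

text \<open>The rank strictly increases at the free row \<open>i\<close>, so no smaller row shares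
  it. This supplies the digit that selects a prescribed partner.\<close>

lemma enc_row_rank:
  assumes "j \<notin> U" "i \<in> {1..n} - insert j U"
  shows "enc_row n (free_mat U) j (card ({1..i} - insert j U)) = i"
  unfolding enc_row_def
proof (rule Least_equality)
  show "is_enc_row n (free_mat U) j (card ({1..i} - insert j U)) i"
    using assms unfolding is_enc_row_def sum_free_mat by auto
  fix k assume "is_enc_row n (free_mat U) j (card ({1..i} - insert j U)) k"
  then have eq: "card ({1..k} - insert j U) = card ({1..i} - insert j U)"
    using assms unfolding is_enc_row_def sum_free_mat by auto
  show "i \<le> k"
  proof (rule ccontr)
    assume "\<not> i \<le> k"
    then have "{1..k} - insert j U \<subseteq> {1..i} - insert j U"
      "i \<in> {1..i} - insert j U" "i \<notin> {1..k} - insert j U" using assms by auto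
    then have "{1..k} - insert j U \<subset> {1..i} - insert j U" by blast
    then show False using eq psubset_card_mono[of "{1..i} - insert j U" "{1..k} - insert j U"] by simp
  qed
qed

text \<open>Since \<open>i\<close> and \<open>j\<close> lie outside \<open>U\<close>, redirecting
  \<open>\<sigma>\<close> at them leaves the recorded pairs intact.\<close>

lemma enc_step_pairing_state:
  assumes "pairing U \<sigma>" "i \<notin> U" "j \<notin> U" "i \<noteq> j"
    and "j = enc_col n (free_mat U)" "i = enc_row n (free_mat U) j a"
  shows "enc_step n a (pairing_state U \<sigma>) =
    pairing_state (insert i (insert j U)) (\<sigma>(i := j, j := i))"
  using assms(2-4) unfolding pairing_state_def enc_step_def Let_def prod.case assms(5,6)[symmetric]
  by (auto simp: fun_eq_iff free_mat_def)

section \<open>Loop invariant and well-definedness\<close>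

definition stage :: "nat \<Rightarrow> nat \<Rightarrow> nat set \<Rightarrow> bool" where
  "stage n t U \<longleftrightarrow> U \<subseteq> {1..n} \<and> card U = 2 * t"

lemma stage_full: "even n \<Longrightarrow> stage n (n div 2) U \<Longrightarrow> U = {1..n}"
  unfolding stage_def by (intro card_subset_eq) auto

lemma stage_extend:
  assumes "stage n t U" "i \<in> {1..n} - U" "j \<in> {1..n} - U" "i \<noteq> j"
  shows "stage n (Suc t) (insert i (insert j U))"
  using assms finite_subset[of U "{1..n}"] unfolding stage_def by auto

text \<open>The number of possible partners equals the radix of the digit consumed; evenness makes
  \<open>n div 2\<close> exact.\<close>

lemma stage_counter:
  assumes "stage n t U" "t < n div 2" "even n"
  shows "n - card U - 1 = 2 * enc_counter n t + 1" "card U + 1 < n"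
proof -
  obtain h where "n = 2 * h" using assms(3) by (auto elim: evenE)
  then show "n - card U - 1 = 2 * enc_counter n t + 1" "card U + 1 < n"
    using assms(1,2) unfolding stage_def enc_counter_def by auto
qed

lemma stage_col:
  assumes "stage n t U" "t < n div 2" "even n" and j: "j = enc_col n (free_mat U)"
  shows "is_enc_col n (free_mat U) j" "j \<in> {1..n} - U"
proof -
  show "is_enc_col n (free_mat U) j"
    unfolding j using is_enc_col_enc_col stage_counter(2)[OF assms(1-3)] assms(1) by (simp add: stage_def)
  then show "j \<in> {1..n} - U" by (rule is_enc_col_free)
qed

lemma stage_row:
  assumes "stage n t U" "t < n div 2" "even n" and j: "j = enc_col n (free_mat U)"
    and a: "a \<in> {1..2 * enc_counter n t + 1}" and i: "i = enc_row n (free_mat U) j a"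
  shows "is_enc_row n (free_mat U) j a i" "i \<in> {1..n} - insert j U"
  using enc_row_free[OF _ stage_col(2)[OF assms(1-4)] _ i] assms(1,5) stage_counter(1)[OF assms(1-3)]
  by (auto simp: stage_def)

text \<open>The loop invariant behind well-definedness, membership in
  \<open>pure_involutions\<close> and injectivity.\<close>

lemma enc_state_pairing:
  assumes "even n" "t \<le> n div 2"
  obtains U \<sigma> where "enc_state n m t = pairing_state U \<sigma>" "pairing U \<sigma>" "stage n t U"
proof -
  have "\<exists>U \<sigma>. enc_state n m t = pairing_state U \<sigma> \<and> pairing U \<sigma> \<and> stage n t U"
    using assms(2)
  proof (induction t)
    case 0
    show ?case
      by (rule exI[of _ "{}"], rule exI[of _ id]) (simp add: pairing_state_empty pairing_def stage_def)
  next
    case (Suc t)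
    then obtain U \<sigma> where U: "enc_state n m t = pairing_state U \<sigma>" "pairing U \<sigma>" "stage n t U" by auto
    define j where "j = enc_col n (free_mat U)"
    define i where "i = enc_row n (free_mat U) j (enc_digit m (enc_counter n t))"
    have t: "t < n div 2" using Suc.prems by simp
    note j = stage_col(2)[OF U(3) t assms(1) j_def]
    note i = stage_row(2)[OF U(3) t assms(1) j_def enc_digit_bounds i_def]
    have "enc_state n m (Suc t) = pairing_state (insert i (insert j U)) (\<sigma>(i := j, j := i))"
      unfolding enc_state.simps U(1) using i j by (intro enc_step_pairing_state[OF U(2) _ _ _ j_def i_def]) auto
    moreover have "pairing (insert i (insert j U)) (\<sigma>(i := j, j := i))"
      by (rule pairing_extend[OF U(2)]) (use i j in auto)
    moreover have "stage n (Suc t) (insert i (insert j U))"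
      by (rule stage_extend[OF U(3)]) (use i j in auto)
    ultimately show ?case by blast
  qed
  then show ?thesis using that by blast
qed

lemma encmap_well_defined_even: "even n \<Longrightarrow> encmap_well_defined n m"
  unfolding encmap_well_defined_def Let_def
proof (intro allI impI)
  fix t assume n: "even n" and t: "t < n div 2"
  obtain U \<sigma> where U: "enc_state n m t = pairing_state U \<sigma>" "stage n t U"
    using enc_state_pairing[OF n less_imp_le[OF t]] by blast
  then have Z: "snd (enc_state n m t) = free_mat U" by (simp add: pairing_state_def)
  show "(\<exists>j. is_enc_col n (snd (enc_state n m t)) j) \<and>
    (\<exists>k. is_enc_row n (snd (enc_state n m t)) (enc_col n (snd (enc_state n m t)))
      (enc_digit m (enc_counter n t)) k)"
    unfolding Z
    using stage_col(1)[OF U(2) t n refl] stage_row(1)[OF U(2) t n refl enc_digit_bounds refl] by blast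
qed

lemma encmap_pairing_state:
  assumes "enc_state n m (n div 2) = pairing_state {1..n} \<sigma>"
  shows "encmap n m = pairing_mat n \<sigma>"
  unfolding encmap_def pairing_mat_def assms
  by (rule eq_matI) (auto simp: pairing_state_def)

lemma encmap_pairing_mat:
  assumes "even n"
  obtains \<sigma> where "pairing {1..n} \<sigma>" "enc_state n m (n div 2) = pairing_state {1..n} \<sigma>"
    "encmap n m = pairing_mat n \<sigma>"
  using enc_state_pairing[OF assms order.refl] stage_full[OF assms] encmap_pairing_state by metis

lemma encmap_in_pure_involutions:
  assumes "even n"
  shows "encmap n m \<in> pure_involutions n"
  by (rule encmap_pairing_mat[OF assms, of m]) (simp add: pairing_mat_in_pure_involutions)

section \<open>Injectivity and surjectivity\<close>

text \<open>Steps write only the value 1 into \<open>X\<close>, so every choice stays visible in the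
  final matrix.\<close>

lemma enc_state_mono:
  assumes "t \<le> u" "fst (enc_state n m t) r c = 1"
  shows "fst (enc_state n m u) r c = 1"
  using assms(1)
proof (induction rule: dec_induct)
  case (step u)
  then show ?case by (cases "enc_state n m u") (simp add: enc_step_def Let_def)
qed (fact assms(2))

lemma fst_enc_step:
  "fst (enc_step n a (X, Z)) (enc_row n Z (enc_col n Z) a) (enc_col n Z) = 1"
  by (simp add: enc_step_def Let_def)

text \<open>Two runs with equal output agree step by step: a common state fixes \<open>j\<close>,
  the common final matrix has a single 1 in column \<open>j\<close>, so the selected rows coincide
  and with them the digits.\<close>

lemma encmap_inj_on:
  assumes n: "even n"
  shows "inj_on (encmap n) {1..num_inputs n}"
proof (rule inj_onI)
  fix m m' assume m: "m \<in> {1..num_inputs n}" "m' \<in> {1..num_inputs n}"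
    and eq: "encmap n m = encmap n m'"
  have sel: "\<exists>U j. snd (enc_state n m t) = free_mat U \<and> stage n t U \<and>
      j = enc_col n (free_mat U) \<and>
      fst (enc_state n m (n div 2)) (enc_row n (free_mat U) j (enc_digit m (enc_counter n t))) j = 1"
    if "t < n div 2" for m t
  proof -
    obtain U \<sigma> where U: "enc_state n m t = pairing_state U \<sigma>" "stage n t U"
      using enc_state_pairing[OF n less_imp_le[OF \<open>t < n div 2\<close>]] by blast
    let ?j = "enc_col n (free_mat U)"
    have "fst (enc_state n m (Suc t)) (enc_row n (free_mat U) ?j (enc_digit m (enc_counter n t))) ?j = 1"
      by (simp add: U(1) pairing_state_def fst_enc_step)
    from enc_state_mono[OF _ this, of "n div 2"] that U show ?thesis
      by (auto simp: pairing_state_def)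
  qed
  obtain \<sigma> where \<sigma>: "pairing {1..n} \<sigma>" "enc_state n m (n div 2) = pairing_state {1..n} \<sigma>"
    "encmap n m = pairing_mat n \<sigma>" using encmap_pairing_mat[OF n, of m] by blast
  obtain \<tau> where \<tau>: "pairing {1..n} \<tau>" "enc_state n m' (n div 2) = pairing_state {1..n} \<tau>"
    "encmap n m' = pairing_mat n \<tau>" using encmap_pairing_mat[OF n, of m'] by blast
  have "\<sigma> x = \<tau> x" if x: "x \<in> {1..n}" for x
  proof -
    have "\<sigma> x \<in> {1..n}" using \<sigma>(1) x by (auto simp: pairing_def)
    then have "pairing_mat n \<sigma> $$ (x - 1, \<sigma> x - 1) = 1"
      using x by (subst pairing_mat_def) (auto simp: Suc_diff_1)
    then have "pairing_mat n \<tau> $$ (x - 1, \<sigma> x - 1) = 1"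
      using eq \<sigma>(3) \<tau>(3) by simp
    then show ?thesis
      using x \<open>\<sigma> x \<in> {1..n}\<close> by (subst (asm) pairing_mat_def) (auto split: if_splits)
  qed
  \<comment> \<open>The output fixes \<open>\<sigma>\<close> and \<open>\<tau>\<close> only on
    \<open>{1..n}\<close>, which is all that the final state depends on.\<close>
  then have final: "enc_state n m (n div 2) = enc_state n m' (n div 2)"
    unfolding \<sigma>(2) \<tau>(2) by (intro pairing_state_cong) auto
  have step: "enc_digit m (enc_counter n t) = enc_digit m' (enc_counter n t)"
    if t: "t < n div 2" and st: "enc_state n m t = enc_state n m' t" for t
  proof -
    define Z where "Z = snd (enc_state n m t)"
    define j where "j = enc_col n Z"
    define i where "i = enc_row n Z j (enc_digit m (enc_counter n t))"
    define i' where "i' = enc_row n Z j (enc_digit m' (enc_counter n t))"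
    obtain U where U: "Z = free_mat U" "stage n t U"
      and X: "fst (enc_state n m (n div 2)) i j = 1"
      using sel[OF t, of m] unfolding Z_def j_def i_def by metis
    have X': "fst (enc_state n m (n div 2)) i' j = 1"
      using sel[OF t, of m'] unfolding final[symmetric] st[symmetric] Z_def j_def i'_def by metis
    have row: "is_enc_row n Z j (enc_digit m (enc_counter n t)) i"
      "is_enc_row n Z j (enc_digit m' (enc_counter n t)) i'"
      using stage_row(1)[OF U(2) t n refl enc_digit_bounds refl]
      unfolding i_def i'_def j_def U(1) by blast+
    have "i \<in> {1..n}" "i' \<in> {1..n}" using row unfolding is_enc_row_def by auto
    moreover have "j = \<sigma> i" "j = \<sigma> i'"
      using X X' unfolding \<sigma>(2) pairing_state_def by (simp_all split: if_splits)
    \<comment> \<open>Applying \<open>\<sigma>\<close> to \<open>j\<close> recovers both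
      rows.\<close>
    ultimately have "i = i'" using \<sigma>(1) unfolding pairing_def by metis
    then show ?thesis using row unfolding is_enc_row_def by simp
  qed
  have st: "enc_state n m t = enc_state n m' t" if "t \<le> n div 2" for t
    using that by (induction t) (simp_all add: step)
  have "enc_digit m p = enc_digit m' p" if "p < n div 2" for p
  proof -
    \<comment> \<open>Digits are consumed in descending order, so digit \<open>p\<close> belongs to
      iteration \<open>n div 2 - 1 - p\<close>.\<close>
    have "n div 2 - 1 - p < n div 2" "enc_counter n (n div 2 - 1 - p) = p"
      using that by (auto simp: enc_counter_def)
    then show ?thesis using step st by (metis less_imp_le)
  qed
  moreover have "enc_rem m (n div 2) = 0" "enc_rem m' (n div 2) = 0"
    using m n by (simp_all add: enc_rem_eq_0)
  ultimately have "enc_rem m 0 = enc_rem m' 0" by (intro enc_digits_inj[of "n div 2"]) auto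
  then show "m = m'" using m by auto
qed

text \<open>A run is first prescribed by \<open>\<sigma>\<close> alone; the ranks of the prescribed
  partners give digits, the digits give \<open>m\<close>, and the run on \<open>m\<close> is then
  seen to be the prescribed one.\<close>

lemma encmap_surj:
  assumes n: "even n" and "A \<in> pure_involutions n"
  shows "\<exists>m\<in>{1..num_inputs n}. encmap n m = A"
proof -
  obtain \<sigma> where \<sigma>: "pairing {1..n} \<sigma>" and A: "A = pairing_mat n \<sigma>"
    using assms(2) by (rule pure_involutionsE)
  define j where "j U = enc_col n (free_mat U)" for U
  \<comment> \<open>\<open>V t\<close> collects the least free index and its partner from each of
    the first \<open>t\<close> iterations, without reference to an input.\<close>
  define V where "V = rec_nat {} (\<lambda>_ U. insert (\<sigma> (j U)) (insert (j U) U))"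
  have V: "V 0 = {}" "V (Suc t) = insert (\<sigma> (j (V t))) (insert (j (V t)) (V t))" for t
    by (simp_all add: V_def)
  have free: "j (V t) \<in> {1..n} - V t" "\<sigma> (j (V t)) \<in> {1..n} - insert (j (V t)) (V t)"
    if "stage n t (V t)" "pairing (V t) \<sigma>" "t < n div 2" for t
  proof -
    show j: "j (V t) \<in> {1..n} - V t" using stage_col(2)[OF that(1,3) n refl] by (simp add: j_def)
    then have s: "\<sigma> (j (V t)) \<in> {1..n}" "\<sigma> (\<sigma> (j (V t))) = j (V t)" "\<sigma> (j (V t)) \<noteq> j (V t)"
      using \<sigma> by (auto simp: pairing_def)
    \<comment> \<open>As \<open>V t\<close> is closed under \<open>\<sigma>\<close>, a partner
      inside it would force \<open>j (V t)\<close> inside as well.\<close>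
    moreover have "\<sigma> (j (V t)) \<notin> V t"
      using that(2) j s(2) unfolding pairing_def by (metis DiffD2)
    ultimately show "\<sigma> (j (V t)) \<in> {1..n} - insert (j (V t)) (V t)" by blast
  qed
  have inv: "stage n t (V t) \<and> pairing (V t) \<sigma>" if "t \<le> n div 2" for t
    using that
  proof (induction t)
    case 0
    then show ?case by (simp add: V stage_def pairing_def)
  next
    case (Suc t)
    then have IH: "stage n t (V t)" "pairing (V t) \<sigma>" "t < n div 2" by auto
    note f = free[OF IH]
    have "pairing (V (Suc t)) \<sigma>"
      using IH(2) \<sigma> f unfolding V pairing_def by (auto dest: sym)
    moreover have "stage n (Suc t) (V (Suc t))"
      unfolding V by (rule stage_extend[OF IH(1)]) (use f in auto)
    ultimately show ?case by blast
  qed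
  \<comment> \<open>The rank of the prescribed partner among the candidates, destined to be the
    digit of iteration \<open>t\<close>.\<close>
  define D where "D t = card ({1..\<sigma> (j (V t))} - insert (j (V t)) (V t))" for t
  have D: "D t \<in> {1..2 * enc_counter n t + 1}" if t: "t < n div 2" for t
  proof -
    have iv: "stage n t (V t)" "pairing (V t) \<sigma>" using inv[of t] t by auto
    note f = free[OF iv t]
    have "D t \<le> card ({1..n} - insert (j (V t)) (V t))"
      unfolding D_def by (intro card_mono) (use f in auto)
    also have "\<dots> = 2 * enc_counter n t + 1"
      using card_free[OF _ f(1)] iv(1) stage_counter(1)[OF iv(1) t n] by (simp add: stage_def)
    finally have "D t \<le> 2 * enc_counter n t + 1" .
    \<comment> \<open>The partner counts itself, so its rank is at least 1.\<close>
    moreover have "\<sigma> (j (V t)) \<in> {1..\<sigma> (j (V t))} - insert (j (V t)) (V t)" using f by auto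
    then have "D t \<noteq> 0" unfolding D_def by (metis card_eq_0_iff empty_iff finite_Diff finite_atLeastAtMost)
    ultimately show ?thesis by simp
  qed
  have "D (n div 2 - 1 - p) \<in> {1..2 * p + 1}" if "p < n div 2" for p
    using D[of "n div 2 - 1 - p"] that by (simp add: enc_counter_def)
  then obtain m where m: "m \<ge> 1" "enc_rem m (n div 2) = 0"
    "\<forall>p<n div 2. enc_digit m p = D (n div 2 - 1 - p)"
    using enc_digits_surj[of "n div 2" "\<lambda>p. D (n div 2 - 1 - p)" 0] by auto
  have digit: "enc_digit m (enc_counter n t) = D t" if "t < n div 2" for t
    using m(3) that by (simp add: enc_counter_def)
  have "enc_state n m t = pairing_state (V t) \<sigma>" if "t \<le> n div 2" for t
    using that
  proof (induction t)
    case 0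
    then show ?case by (simp add: V pairing_state_empty)
  next
    case (Suc t)
    then have t: "t < n div 2" and IH: "enc_state n m t = pairing_state (V t) \<sigma>" by auto
    have iv: "stage n t (V t)" "pairing (V t) \<sigma>" using inv[of t] t by auto
    let ?j = "j (V t)" and ?i = "\<sigma> (j (V t))"
    note f = free[OF iv t]
    have "?i = enc_row n (free_mat (V t)) ?j (enc_digit m (enc_counter n t))"
      unfolding digit[OF t] D_def using f by (intro enc_row_rank[symmetric]) auto
    then have "enc_state n m (Suc t) = pairing_state (V (Suc t)) (\<sigma>(?i := ?j, ?j := ?i))"
      unfolding enc_state.simps IH V using f
      by (intro enc_step_pairing_state[OF iv(2)]) (auto simp: j_def)
    \<comment> \<open>\<open>\<sigma>\<close> already exchanges \<open>?i\<close> and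
      \<open>?j\<close>, so the update changes nothing.\<close>
    also have "\<dots> = pairing_state (V (Suc t)) \<sigma>"
      using \<sigma> f by (intro pairing_state_cong) (auto simp: pairing_def)
    finally show ?case .
  qed
  then have "enc_state n m (n div 2) = pairing_state {1..n} \<sigma>"
    using inv[of "n div 2"] stage_full[OF n] by auto
  then have "encmap n m = A" using A encmap_pairing_state by simp
  moreover have "m \<in> {1..num_inputs n}" using m(1,2) n by (simp add: enc_rem_eq_0)
  ultimately show ?thesis by blast
qed

lemma encmap_bij_betw:
  assumes "even n"
  shows "bij_betw (encmap n) {1..num_inputs n} (pure_involutions n)"
  unfolding bij_betw_def
  using encmap_inj_on[OF assms] encmap_in_pure_involutions[OF assms] encmap_surj[OF assms] by blast

section \<open>Time-bounded execution\<close>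

text \<open>A total-correctness triple with time budget \<open>B\<close>. Since \<open>exec\<close>
  is deterministic, the existential speaks about the only possible run.\<close>

definition runs :: "'v com \<Rightarrow> 'v memory \<Rightarrow> nat \<Rightarrow> ('v memory \<Rightarrow> bool) \<Rightarrow> bool" where
  "runs c s B Q \<longleftrightarrow> (\<exists>t s'. exec c s t s' \<and> t \<le> B \<and> Q s')"

lemma runs_Put:
  assumes "Q (s(v := (s v)(map (\<lambda>e. aval e s) es := aval e s)))"
    and "1 + (\<Sum>e'\<leftarrow>es. acost e') + acost e \<le> B"
  shows "runs (Put v es e) s B Q"
  unfolding runs_def by (intro exI conjI, rule exec_Put) (fact assms)+

text \<open>The second program receives the rest of the budget; \<open>B1 \<le> B\<close> stops
  truncated subtraction from creating time.\<close>

lemma runs_Seq: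
  assumes "runs c1 s B1 R" "B1 \<le> B" "\<And>s'. R s' \<Longrightarrow> runs c2 s' (B - B1) Q"
  shows "runs (c1 ;; c2) s B Q"
proof -
  obtain t1 s' where 1: "exec c1 s t1 s'" "t1 \<le> B1" "R s'" using assms(1) unfolding runs_def by blast
  obtain t2 s'' where 2: "exec c2 s' t2 s''" "t2 \<le> B - B1" "Q s''"
    using assms(3)[OF 1(3)] unfolding runs_def by blast
  have "t1 + t2 \<le> B" using 1 2 assms(2) by simp
  then show ?thesis using exec_Seq[OF 1(1) 2(1)] 2(3) unfolding runs_def by blast
qed

text \<open>Taking the exact updated memory as intermediate assertion yields symbolic execution of
  assignments.\<close>

lemma runs_Put_Seq:
  assumes "runs c (s(v := (s v)(map (\<lambda>e. aval e s) es := aval e s)))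
      (B - (1 + (\<Sum>e'\<leftarrow>es. acost e') + acost e)) Q"
    and "1 + (\<Sum>e'\<leftarrow>es. acost e') + acost e \<le> B"
  shows "runs (Put v es e ;; c) s B Q"
  by (rule runs_Seq[OF runs_Put[of "\<lambda>s'. s' = s(v := (s v)(map (\<lambda>e. aval e s) es := aval e s))"]
        assms(2)])
    (use assms(1) in auto)

lemma runs_mono:
  "runs c s B Q \<Longrightarrow> B \<le> B' \<Longrightarrow> (\<And>s'. Q s' \<Longrightarrow> Q' s') \<Longrightarrow> runs c s B' Q'"
  unfolding runs_def by (meson order.trans)

text \<open>\<open>k\<close> is only an upper bound for the remaining passes, so the loop may stop
  early. Each pass pays for test and body, and one failing test comes on top.\<close>

lemma runs_While:
  assumes "I k s"
    and "\<And>k s. I k s \<Longrightarrow> if bval b s then k > 0 \<and> runs c s B (I (k - 1)) else Q s"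
    and "k * (B + bcost b) + bcost b \<le> T"
  shows "runs (While b c) s T Q"
proof -
  have "runs (While b c) s (k * (B + bcost b) + bcost b) Q"
    using assms(1)
  proof (induction k arbitrary: s)
    case 0
    then have "\<not> bval b s" "Q s" using assms(2)[OF 0] by (auto split: if_splits)
    then show ?case using exec_While_False[of b s c] unfolding runs_def by auto
  next
    case (Suc k)
    show ?case
    proof (cases "bval b s")
      case True
      then obtain t1 s' where 1: "exec c s t1 s'" "t1 \<le> B" "I k s'"
        using assms(2)[OF Suc.prems] unfolding runs_def by auto
      obtain t2 s'' where 2: "exec (While b c) s' t2 s''" "t2 \<le> k * (B + bcost b) + bcost b" "Q s''"
        using Suc.IH[OF 1(3)] unfolding runs_def by blast
      have "bcost b + t1 + t2 \<le> Suc k * (B + bcost b) + bcost b" using 1 2 by simp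
      then show ?thesis using exec_While_True[OF True 1(1) 2(1)] 2(3) unfolding runs_def by blast
    next
      case False
      then have "Q s" using assms(2)[OF Suc.prems] by simp
      moreover have "bcost b \<le> Suc k * (B + bcost b) + bcost b" by simp
      ultimately show ?thesis using exec_While_False[OF False, of c] unfolding runs_def by blast
    qed
  qed
  then show ?thesis using assms(3) by (rule runs_mono)
qed

text \<open>Here \<open>b\<close> is the first value not visited. Besides the body, a pass pays 4
  for the increment and \<open>acost hi + 2\<close> for the test; \<open>hi\<close> is evaluated
  anew each time, so the invariant must fix its value.\<close>

lemma runs_For:
  assumes "aval lo s = int a" "a \<le> b" "I a (s(v := (s v)([] := int a)))"
    and step: "\<And>k s. a \<le> k \<Longrightarrow> k < b \<Longrightarrow> I k s \<Longrightarrow> s v [] = int k \<Longrightarrow>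
      runs c s B (\<lambda>s'. s' v [] = int k \<and> I (Suc k) (s'(v := (s' v)([] := int (Suc k)))))"
    and hi: "\<And>k s. I k s \<Longrightarrow> aval hi s = int b - 1"
    and fin: "\<And>s'. I b s' \<Longrightarrow> Q s'"
    and T: "acost lo + acost hi + 3 + (b - a) * (B + acost hi + 6) \<le> T"
  shows "runs (For v lo hi c) s T Q"
proof -
  \<comment> \<open>\<open>runs_While\<close> counts downwards, so the invariant is reindexed by the
    number \<open>r\<close> of passes left.\<close>
  define J where "J r s \<longleftrightarrow> r \<le> b - a \<and> I (b - r) s \<and> s v [] = int (b - r)" for r s
  let ?b = "Cmp Le (Var v) hi" and ?c = "c ;; Set v (Op Add (Var v) (Lit 1))"
  let ?s = "s(v := (s v)([] := int a))"
  have "runs (While ?b ?c) ?s (T - (1 + acost lo)) Q"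
  proof (rule runs_While)
    show "J (b - a) ?s" using assms(2,3) by (simp add: J_def)
    show "(b - a) * (B + 4 + bcost ?b) + bcost ?b \<le> T - (1 + acost lo)"
      using T by (simp add: algebra_simps)
    fix r s assume J: "J r s"
    then have hi': "aval hi s = int b - 1" using hi unfolding J_def by blast
    show "if bval ?b s then r > 0 \<and> runs ?c s (B + 4) (J (r - 1)) else Q s"
    proof (cases "r = 0")
      case True
      then show ?thesis using J hi' fin by (simp add: J_def)
    next
      case False
      define k where "k = b - r"
      have k: "a \<le> k" "k < b" "I k s" "s v [] = int k" "b - (r - 1) = Suc k" "r - 1 \<le> b - a"
        using False J assms(2) by (auto simp: J_def k_def)
      have "runs ?c s (B + 4) (J (r - 1))"
        by (rule runs_Seq[OF step[OF k(1-4)]], simp, rule runs_Put)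
          (use k in \<open>auto simp: J_def fun_upd_def add.commute\<close>)
      then show ?thesis using False k hi' by simp
    qed
  qed
  then show ?thesis
    unfolding For_def by (intro runs_Put_Seq) (use assms(1) T in auto)
qed

primrec writes :: "'v com \<Rightarrow> 'v set" where
  "writes (Put v es e) = {v}"
| "writes (c1 ;; c2) = writes c1 \<union> writes c2"
| "writes (While b c) = writes c"

text \<open>A syntactic frame rule for whole arrays; it spares later specifications from listing
  untouched data.\<close>

lemma exec_frame: "exec c s t s' \<Longrightarrow> v \<notin> writes c \<Longrightarrow> s' v = s v"
  by (induction rule: exec.induct) auto

lemma runs_frame:
  "runs c s B Q \<Longrightarrow> runs c s B (\<lambda>s'. Q s' \<and> (\<forall>v. v \<notin> writes c \<longrightarrow> s' v = s v))"
  unfolding runs_def using exec_frame by metis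

section \<open>Running time of EncMap\<close>

text \<open>Before pass \<open>k\<close> the cell \<open>RM\<close> holds
  \<open>enc_rem m k\<close>. Positivity of \<open>m\<close> makes the initial integer subtraction
  agree with the natural number \<open>m - 1\<close>.\<close>

lemma runs_digits_prog:
  assumes "s RN [] = int n" "s RM [] = int m" "m > 0"
  shows "runs digits_prog s (30 * n + 20)
    (\<lambda>s'. s' RN [] = int n \<and> (\<forall>p<n div 2. s' RA [int p] = int (enc_digit m p)))"
proof -
  define I where "I k s \<longleftrightarrow> s RN [] = int n \<and> s RM [] = int (enc_rem m k) \<and>
    (\<forall>p<k. s RA [int p] = int (enc_digit m p))" for k and s :: "cell memory"
  show ?thesis
    unfolding digits_prog_def Let_def
  proof (rule runs_Put_Seq, rule runs_For[where I = I and a = 0 and b = "n div 2" and B = 19])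
    fix k and s :: "cell memory"
    assume I: "I k s" and k: "s RP [] = int k"
    have digit: "int (enc_rem m k) mod (2 * int k + 1) + 1 = int (enc_digit m k)"
      by (simp add: enc_digit_def zmod_int add.commute)
    have quot: "int (enc_rem m k) div (2 * int k + 1) = int (enc_rem m (Suc k))"
      by (simp add: zdiv_int add.commute)
    show "runs
        (Put RA [Var RP] (Op Add (Op Mod (Var RM) (Op Add (Op Mul (Lit 2) (Var RP)) (Lit 1))) (Lit 1)) ;;
         Set RM (Op Div (Var RM) (Op Add (Op Mul (Lit 2) (Var RP)) (Lit 1)))) s 19
        (\<lambda>s'. s' RP [] = int k \<and> I (Suc k) (s'(RP := (s' RP)([] := int (Suc k)))))"
      by (intro runs_Put_Seq runs_Put)
        (use I k digit quot in \<open>auto simp: I_def less_Suc_eq simp del: enc_rem.simps\<close>)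
  qed (use assms in \<open>auto simp: I_def zdiv_int\<close>)
qed

section \<open>Initialisation and stored column sums\<close>

text \<open>Phrased through the arrays in memory instead of an abstract \<open>Z\<close>, so that it
  also applies in the middle of the clearing loop.\<close>

definition col_sums :: "nat \<Rightarrow> cell memory \<Rightarrow> bool" where
  "col_sums n s \<longleftrightarrow> (\<forall>c\<in>{1..n}. s RCol [int c] = (\<Sum>r=1..n. s RZ [int r, int c]))"

lemma runs_init_X_Z:
  assumes "s RN [] = int n"
  shows "runs (For RI (Lit 1) (Var RN) (For RJ (Lit 1) (Var RN)
       (Put RX [Var RI, Var RJ] (Lit 0) ;; Put RZ [Var RI, Var RJ] (Lit 1)))) s (5 + n * (15 * n + 12))
    (\<lambda>s'. \<forall>r\<in>{1..n}. \<forall>c\<in>{1..n}. s' RX [int r, int c] = 0 \<and> s' RZ [int r, int c] = 1)"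
proof -
  define I where "I k s \<longleftrightarrow> s RN [] = int n \<and>
    (\<forall>r\<in>{1..<k}. \<forall>c\<in>{1..n}. s RX [int r, int c] = 0 \<and> s RZ [int r, int c] = 1)"
    for k and s :: "cell memory"
  \<comment> \<open>\<open>I\<close> covers the finished rows; \<open>J\<close> adds the part of row
    \<open>k\<close> already visited by the inner loop.\<close>
  define J where "J k l s \<longleftrightarrow> I k s \<and> s RI [] = int k \<and>
    (\<forall>c\<in>{1..<l}. s RX [int k, int c] = 0 \<and> s RZ [int k, int c] = 1)"
    for k l and s :: "cell memory"
  show ?thesis
  proof (rule runs_For[where I = I and a = 1 and b = "n + 1" and B = "15 * n + 5"])
    fix k s
    assume k: "1 \<le> k" "k < n + 1" "I k s" "s RI [] = int k"
    show "runs (For RJ (Lit 1) (Var RN)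
          (Put RX [Var RI, Var RJ] (Lit 0) ;; Put RZ [Var RI, Var RJ] (Lit 1))) s (15 * n + 5)
        (\<lambda>s'. s' RI [] = int k \<and> I (Suc k) (s'(RI := (s' RI)([] := int (Suc k)))))"
    proof (rule runs_For[where I = "J k" and a = 1 and b = "n + 1" and B = 8])
      fix l s
      assume "1 \<le> l" "l < n + 1" "J k l s" "s RJ [] = int l"
      then show "runs (Put RX [Var RI, Var RJ] (Lit 0) ;; Put RZ [Var RI, Var RJ] (Lit 1)) s 8
          (\<lambda>s'. s' RJ [] = int l \<and> J k (Suc l) (s'(RJ := (s' RJ)([] := int (Suc l)))))"
        by (intro runs_Put_Seq runs_Put) (auto simp: J_def I_def less_Suc_eq)
    next
      fix s'
      assume "J k (n + 1) s'"
      then have "I k s'" "s' RI [] = int k"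
        "\<forall>c\<in>{1..n}. s' RX [int k, int c] = 0 \<and> s' RZ [int k, int c] = 1"
        by (simp_all add: J_def atLeastLessThanSuc_atLeastAtMost)
      then show "s' RI [] = int k \<and> I (Suc k) (s'(RI := (s' RI)([] := int (Suc k))))"
        using k(1) by (simp add: I_def atLeastLessThanSuc)
    qed (use k in \<open>auto simp: J_def I_def\<close>)
  qed (use assms in \<open>auto simp: I_def\<close>)
qed

lemma runs_init_diag:
  assumes "s RN [] = int n"
    and "\<forall>r\<in>{1..n}. \<forall>c\<in>{1..n}. s RX [int r, int c] = 0 \<and> s RZ [int r, int c] = 1"
  shows "runs (For RI (Lit 1) (Var RN) (Put RZ [Var RI, Var RI] (Lit 0))) s (5 + n * 11)
    (\<lambda>s'. \<forall>r\<in>{1..n}. \<forall>c\<in>{1..n}. s' RX [int r, int c] = 0 \<and>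
      s' RZ [int r, int c] = (if r = c then 0 else 1))"
proof -
  define I where "I k s \<longleftrightarrow> s RN [] = int n \<and>
    (\<forall>r\<in>{1..n}. \<forall>c\<in>{1..n}. s RX [int r, int c] = 0 \<and>
      s RZ [int r, int c] = (if r = c \<and> r < k then 0 else 1))"
    for k and s :: "cell memory"
  show ?thesis
  proof (rule runs_For[where I = I and a = 1 and b = "n + 1" and B = 4])
    fix k s
    assume "1 \<le> k" "k < n + 1" "I k s" "s RI [] = int k"
    then show "runs (Put RZ [Var RI, Var RI] (Lit 0)) s 4
        (\<lambda>s'. s' RI [] = int k \<and> I (Suc k) (s'(RI := (s' RI)([] := int (Suc k)))))"
      by (intro runs_Put) (auto simp: I_def less_Suc_eq)
  qed (use assms in \<open>auto simp: I_def\<close>)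
qed

lemma runs_init_col_sums:
  assumes "s RN [] = int n"
  shows "runs (For RJ (Lit 1) (Var RN)
       (Put RCol [Var RJ] (Lit 0) ;;
        For RI (Lit 1) (Var RN)
          (Put RCol [Var RJ] (Op Add (Get RCol [Var RJ]) (Get RZ [Var RI, Var RJ]))))) s
    (5 + n * (15 * n + 15)) (col_sums n)"
proof -
  define I where "I k s \<longleftrightarrow> s RN [] = int n \<and>
    (\<forall>c\<in>{1..<k}. s RCol [int c] = (\<Sum>r=1..n. s RZ [int r, int c]))"
    for k and s :: "cell memory"
  define J where "J k l s \<longleftrightarrow> I k s \<and> s RJ [] = int k \<and>
    s RCol [int k] = (\<Sum>r=1..<l. s RZ [int r, int k])"
    for k l and s :: "cell memory"
  show ?thesis
  proof (rule runs_For[where I = I and a = 1 and b = "n + 1" and B = "15 * n + 8"])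
    fix k s
    assume k: "1 \<le> k" "k < n + 1" "I k s" "s RJ [] = int k"
    let ?s = "s(RCol := (s RCol)([int k] := 0))"
    have J: "J k 1 (?s(RI := (?s RI)([] := 1)))"
      using k by (simp add: J_def I_def)
    have "runs (For RI (Lit 1) (Var RN)
          (Put RCol [Var RJ] (Op Add (Get RCol [Var RJ]) (Get RZ [Var RI, Var RJ])))) ?s (15 * n + 5)
        (\<lambda>s'. s' RJ [] = int k \<and> I (Suc k) (s'(RJ := (s' RJ)([] := int (Suc k)))))"
    proof (rule runs_For[where I = "J k" and a = 1 and b = "n + 1" and B = 8])
      fix l s
      assume "1 \<le> l" "l < n + 1" "J k l s" "s RI [] = int l"
      then show "runs (Put RCol [Var RJ] (Op Add (Get RCol [Var RJ]) (Get RZ [Var RI, Var RJ]))) s 8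
          (\<lambda>s'. s' RI [] = int l \<and> J k (Suc l) (s'(RI := (s' RI)([] := int (Suc l)))))"
        by (intro runs_Put) (auto simp: J_def I_def)
    next
      fix s'
      assume "J k (n + 1) s'"
      then have "I k s'" "s' RJ [] = int k" "s' RCol [int k] = (\<Sum>r=1..n. s' RZ [int r, int k])"
        by (simp_all add: J_def atLeastLessThanSuc_atLeastAtMost)
      then show "s' RJ [] = int k \<and> I (Suc k) (s'(RJ := (s' RJ)([] := int (Suc k))))"
        using k(1) by (simp add: I_def atLeastLessThanSuc)
    qed (use J in \<open>auto simp: J_def I_def\<close>)
    then show "runs (Put RCol [Var RJ] (Lit 0) ;; For RI (Lit 1) (Var RN)
          (Put RCol [Var RJ] (Op Add (Get RCol [Var RJ]) (Get RZ [Var RI, Var RJ])))) s (15 * n + 8)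
        (\<lambda>s'. s' RJ [] = int k \<and> I (Suc k) (s'(RJ := (s' RJ)([] := int (Suc k)))))"
      using k by (intro runs_Put_Seq) (auto elim!: runs_mono)
  qed (use assms in \<open>auto simp: I_def col_sums_def\<close>)
qed

text \<open>Agreement is confined to indices \<open>1..n\<close>: the abstract arrays are defined
  everywhere, while memory outside this range is arbitrary.\<close>

definition represents :: "nat \<Rightarrow> cell memory \<Rightarrow> enc_state \<Rightarrow> bool" where
  "represents n s st \<longleftrightarrow> s RN [] = int n \<and> col_sums n s \<and>
     (\<forall>r\<in>{1..n}. \<forall>c\<in>{1..n}. s RX [int r, int c] = fst st r c \<and>
        s RZ [int r, int c] = int (snd st r c))"

lemma runs_init_prog:
  assumes "s RN [] = int n"
  shows "runs init_prog s (15 + n * (30 * n + 38)) (\<lambda>s'. represents n s' enc_init)"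
  unfolding init_prog_def
proof (rule runs_Seq[OF runs_frame[OF runs_init_X_Z[where s = s and n = n, OF assms]]])
  fix s1
  let ?c1 = "For RI (Lit 1) (Var RN) (For RJ (Lit 1) (Var RN)
       (Put RX [Var RI, Var RJ] (Lit 0) ;; Put RZ [Var RI, Var RJ] (Lit 1)))"
  assume 1: "(\<forall>r\<in>{1..n}. \<forall>c\<in>{1..n}. s1 RX [int r, int c] = 0 \<and> s1 RZ [int r, int c] = 1) \<and>
      (\<forall>v. v \<notin> writes ?c1 \<longrightarrow> s1 v = s v)"
  then have N1: "s1 RN [] = int n" using assms by (simp add: For_def)
  let ?c2 = "For RI (Lit 1) (Var RN) (Put RZ [Var RI, Var RI] (Lit 0))"
  let ?c3 = "For RJ (Lit 1) (Var RN)
       (Put RCol [Var RJ] (Lit 0) ;;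
        For RI (Lit 1) (Var RN)
          (Put RCol [Var RJ] (Op Add (Get RCol [Var RJ]) (Get RZ [Var RI, Var RJ]))))"
  show "runs (?c2 ;; ?c3) s1 (15 + n * (30 * n + 38) - (5 + n * (15 * n + 12)))
     (\<lambda>s'. represents n s' enc_init)"
  proof (rule runs_Seq[OF runs_frame[OF runs_init_diag[where s = s1 and n = n, OF N1]]])
    fix s2
    assume 2: "(\<forall>r\<in>{1..n}. \<forall>c\<in>{1..n}. s2 RX [int r, int c] = 0 \<and>
        s2 RZ [int r, int c] = (if r = c then 0 else 1)) \<and>
      (\<forall>v. v \<notin> writes ?c2 \<longrightarrow> s2 v = s1 v)"
    then have N2: "s2 RN [] = int n" using N1 by (simp add: For_def)
    show "runs ?c3 s2 (15 + n * (30 * n + 38) - (5 + n * (15 * n + 12)) - (5 + n * 11))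
      (\<lambda>s'. represents n s' enc_init)"
      \<comment> \<open>The last loop does not write \<open>RX\<close> or \<open>RZ\<close>, so the
        entries set before remain valid.\<close>
      by (rule runs_mono[OF runs_frame[OF runs_init_col_sums[where s = s2 and n = n, OF N2]]])
        (use conjunct1[OF 2] N2 in \<open>simp_all add: algebra_simps represents_def For_def enc_init_def\<close>)
  qed (use 1 in \<open>simp_all add: algebra_simps\<close>)
qed (simp add: algebra_simps)

section \<open>The two searches\<close>

lemma represents_col_sum:
  assumes "represents n s (X, Z)" "c \<in> {1..n}"
  shows "s RCol [int c] = int (\<Sum>r=1..n. Z r c)"
  using assms by (auto simp: represents_def col_sums_def intro!: sum.cong)

text \<open>By minimality of \<open>j\<close> the guard holds at every earlier column and fails at
  \<open>j\<close>; the loop bound is the distance to \<open>j\<close>.\<close>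

lemma runs_find_col_prog:
  assumes "represents n s (X, Z)" "is_enc_col n Z j'" and j: "j = enc_col n Z"
  shows "runs find_col_prog s (8 * n + 6) (\<lambda>s'. s' = s(RJ := (s RJ)([] := int j)))"
proof -
  have col: "is_enc_col n Z j" unfolding j enc_col_def by (rule LeastI) (fact assms(2))
  then have jn: "j \<in> {1..n}" by (simp add: is_enc_col_def)
  have test: "s RCol [int k] \<le> 0 \<longleftrightarrow> k \<noteq> j" if "k \<in> {1..j}" for k
  proof -
    have "s RCol [int k] \<le> 0 \<longleftrightarrow> \<not> is_enc_col n Z k"
      using that jn represents_col_sum[OF assms(1), of k] by (auto simp: is_enc_col_def simp del: of_nat_sum)
    also have "\<dots> \<longleftrightarrow> k \<noteq> j"
      using col that not_less_Least[of k "is_enc_col n Z"] unfolding j enc_col_def by fastforce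
    finally show ?thesis .
  qed
  define I where "I k s' \<longleftrightarrow> k < j \<and> s' = s(RJ := (s RJ)([] := int (j - k)))" for k s'
  show ?thesis
    unfolding find_col_prog_def
  proof (rule runs_Put_Seq, rule runs_While[where I = I and k = "j - 1" and B = 4])
    fix k s'
    assume I: "I k s'"
    show "if bval (Cmp Le (Get RCol [Var RJ]) (Lit 0)) s'
      then k > 0 \<and> runs (Set RJ (Op Add (Var RJ) (Lit 1))) s' 4 (I (k - 1))
      else s' = s(RJ := (s RJ)([] := int j))"
    proof (cases "k = 0")
      case True
      then show ?thesis using I test[of j] jn by (simp add: I_def)
    next
      case False
      have "runs (Set RJ (Op Add (Var RJ) (Lit 1))) s' 4 (I (k - 1))"
        by (rule runs_Put) (use I False in \<open>auto simp: I_def of_nat_diff algebra_simps\<close>)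
      moreover have "s RCol [int (j - k)] \<le> 0"
        using test[of "j - k"] I False by (auto simp: I_def simp del: of_nat_diff)
      then have "bval (Cmp Le (Get RCol [Var RJ]) (Lit 0)) s'"
        using I by (simp add: I_def del: of_nat_diff)
      ultimately show ?thesis using False by simp
    qed
  qed (use jn in \<open>auto simp: I_def\<close>)
qed

text \<open>The guard tests for inequality only, so termination rests on \<open>i\<close> being the
  least row whose prefix sum is \<open>a\<close>.\<close>

lemma runs_find_row_prog:
  assumes rep: "represents n s (X, Z)" and j: "s RJ [] = int j" "j \<in> {1..n}"
    and a: "s RA [s RP []] = int a"
    and "is_enc_row n Z j a i'" and i: "i = enc_row n Z j a"
  shows "runs find_row_prog s (14 * n + 10)
    (\<lambda>s'. s' RI [] = int i \<and> (\<forall>v. v \<notin> {RI, RSum} \<longrightarrow> s' v = s v))"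
proof -
  let ?f = "\<lambda>k. \<Sum>r=1..k. Z r j"
  have row: "is_enc_row n Z j a i" unfolding i enc_row_def by (rule LeastI) (fact assms(5))
  then have in': "i \<in> {1..n}" by (simp add: is_enc_row_def)
  have test: "?f k = a \<longleftrightarrow> k = i" if "k \<in> {1..i}" for k
  proof -
    have "?f k = a \<longleftrightarrow> is_enc_row n Z j a k" using that in' by (auto simp: is_enc_row_def)
    also have "\<dots> \<longleftrightarrow> k = i"
      using row that not_less_Least[of k "is_enc_row n Z j a"] unfolding i enc_row_def by fastforce
    finally show ?thesis .
  qed
  have Z: "s RZ [int r, int j] = int (Z r j)" if "r \<in> {1..n}" for r
    using rep j(2) that by (simp add: represents_def)
  \<comment> \<open>\<open>RSum\<close> is the prefix sum up to the current row
    \<open>i - k\<close>, with \<open>k\<close> rows still to go.\<close>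
  define I where "I k s' \<longleftrightarrow> k < i \<and> s' RI [] = int (i - k) \<and> s' RSum [] = int (?f (i - k)) \<and>
    (\<forall>v. v \<notin> {RI, RSum} \<longrightarrow> s' v = s v)" for k s'
  show ?thesis
    unfolding find_row_prog_def
  proof (rule runs_Put_Seq, rule runs_Put_Seq,
      rule runs_While[where I = I and k = "i - 1" and B = 10])
    fix k s'
    assume I: "I k s'"
    have "i - k \<in> {1..i}" "i - k = i \<longleftrightarrow> k = 0" using I by (auto simp: I_def)
    then have "?f (i - k) = a \<longleftrightarrow> k = 0" using test by blast
    moreover have "bval (Cmp Neq (Var RSum) (Get RA [Var RP])) s' \<longleftrightarrow> int (?f (i - k)) \<noteq> int a"
      using I a by (simp add: I_def del: of_nat_sum of_nat_diff)
    ultimately have "bval (Cmp Neq (Var RSum) (Get RA [Var RP])) s' \<longleftrightarrow> k \<noteq> 0"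
      by (simp only: of_nat_eq_iff)
    moreover have "runs (Set RI (Op Add (Var RI) (Lit 1)) ;;
        Set RSum (Op Add (Var RSum) (Get RZ [Var RI, Var RJ]))) s' 10 (I (k - 1))" if "k \<noteq> 0"
    proof -
      have k: "i - (k - 1) = Suc (i - k)" "Suc (i - k) \<in> {1..n}"
        using that I in' by (auto simp: I_def)
      then have "int (i - k) + 1 = int (Suc (i - k))" by simp
      then show ?thesis
        by (intro runs_Put_Seq runs_Put)
          (use I k j(1) Z[OF k(2)] in \<open>auto simp: I_def simp del: of_nat_Suc\<close>)
    qed
    ultimately show "if bval (Cmp Neq (Var RSum) (Get RA [Var RP])) s'
      then k > 0 \<and> runs (Set RI (Op Add (Var RI) (Lit 1)) ;;
        Set RSum (Op Add (Var RSum) (Get RZ [Var RI, Var RJ]))) s' 10 (I (k - 1))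
      else s' RI [] = int i \<and> (\<forall>v. v \<notin> {RI, RSum} \<longrightarrow> s' v = s v)"
      using I by (auto simp: I_def)
  qed (use in' j(1) Z[of 1] in \<open>auto simp: I_def\<close>)
qed

section \<open>Clearing rows and columns\<close>

text \<open>The old entry is subtracted before it is erased, so clearing an entry that is already 0
  is harmless.\<close>

lemma runs_clear_prog:
  assumes "s u [] = int r" "s v [] = int c" "r \<in> {1..n}" "c \<in> {1..n}"
    "u \<notin> {RZ, RCol}" "v \<notin> {RZ, RCol}" "col_sums n s"
  shows "runs (clear_prog u v) s 12 (\<lambda>s'. col_sums n s' \<and>
    s' RZ = (s RZ)([int r, int c] := 0) \<and> (\<forall>w. w \<notin> {RZ, RCol} \<longrightarrow> s' w = s w))"
proof -
  let ?s = "s(RCol := (s RCol)([int c] := s RCol [int c] - s RZ [int r, int c]),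
    RZ := (s RZ)([int r, int c] := 0))"
  have "col_sums n ?s"
    unfolding col_sums_def
  proof
    fix c' assume c': "c' \<in> {1..n}"
    have sum: "s RCol [int c'] = (\<Sum>r=1..n. s RZ [int r, int c'])"
      using assms(7) c' by (simp add: col_sums_def)
    show "?s RCol [int c'] = (\<Sum>r'=1..n. ?s RZ [int r', int c'])"
    proof (cases "c' = c")
      case True
      \<comment> \<open>Row \<open>r\<close> is split off: it contributes 0 after the store and the
        subtracted entry before it.\<close>
      have "(\<Sum>r'=1..n. ?s RZ [int r', int c']) = (\<Sum>r'\<in>{1..n} - {r}. s RZ [int r', int c])"
        using assms(3) True by (subst sum.remove[of _ r]) (auto intro!: sum.cong)
      also have "\<dots> = s RCol [int c] - s RZ [int r, int c]"
        using assms(3) sum True by (subst (asm) sum.remove[of _ r]) auto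
      finally show ?thesis using True by simp
    qed (use sum in simp)
  qed
  then show ?thesis
    unfolding clear_prog_def
    by (intro runs_Put_Seq runs_Put) (use assms in auto)
qed

text \<open>Before pass \<open>q\<close> the first \<open>q - 1\<close> entries of both rows and
  both columns are cleared; at \<open>q = n + 1\<close> the whole cross is. A pass costs four calls
  of 12 plus 7 for the loop.\<close>

lemma runs_clear_loop:
  assumes "s RN [] = int n" "s RI [] = int i" "s RJ [] = int j" "i \<in> {1..n}" "j \<in> {1..n}"
    "col_sums n s"
  shows "runs (For RQ (Lit 1) (Var RN)
      (clear_prog RQ RJ ;; clear_prog RJ RQ ;; clear_prog RI RQ ;; clear_prog RQ RI)) s (55 * n + 5)
    (\<lambda>s'. col_sums n s' \<and> (\<forall>r\<in>{1..n}. \<forall>c\<in>{1..n}.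
       s' RZ [int r, int c] = (if r \<in> {i, j} \<or> c \<in> {i, j} then 0 else s RZ [int r, int c])))"
proof -
  define I where "I q s' \<longleftrightarrow> col_sums n s' \<and>
    (\<forall>r\<in>{1..n}. \<forall>c\<in>{1..n}. s' RZ [int r, int c] =
       (if r \<in> {i, j} \<and> c < q \<or> c \<in> {i, j} \<and> r < q then 0 else s RZ [int r, int c])) \<and>
    (\<forall>w. w \<notin> {RZ, RCol, RQ} \<longrightarrow> s' w = s w)" for q s'
  show ?thesis
  proof (rule runs_For[where I = I and a = 1 and b = "n + 1" and B = 48])
    fix q s0
    assume q: "1 \<le> q" "q < n + 1" and I: "I q s0" and "s0 RQ [] = int q"
    then have s0: "s0 RQ [] = int q" "s0 RI [] = int i" "s0 RJ [] = int j" "col_sums n s0"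
      using assms by (simp_all add: I_def)
    have q': "q \<in> {1..n}" using q by simp
    let ?R = "\<lambda>s r c s'. col_sums n s' \<and> s' RZ = (s RZ)([int r, int c] := 0) \<and>
      (\<forall>w. w \<notin> {RZ, RCol} \<longrightarrow> s' w = s w)"
    show "runs (clear_prog RQ RJ ;; clear_prog RJ RQ ;; clear_prog RI RQ ;; clear_prog RQ RI) s0 48
        (\<lambda>s'. s' RQ [] = int q \<and> I (Suc q) (s'(RQ := (s' RQ)([] := int (Suc q)))))"
    proof (rule runs_Seq[OF runs_clear_prog[where r = q and c = j and n = n]])
      fix s1 assume 1: "?R s0 q j s1"
      show "runs (clear_prog RJ RQ ;; clear_prog RI RQ ;; clear_prog RQ RI) s1 (48 - 12)
        (\<lambda>s'. s' RQ [] = int q \<and> I (Suc q) (s'(RQ := (s' RQ)([] := int (Suc q)))))"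
      proof (rule runs_Seq[OF runs_clear_prog[where r = j and c = q and n = n]])
        fix s2 assume 2: "?R s1 j q s2"
        show "runs (clear_prog RI RQ ;; clear_prog RQ RI) s2 (48 - 12 - 12)
          (\<lambda>s'. s' RQ [] = int q \<and> I (Suc q) (s'(RQ := (s' RQ)([] := int (Suc q)))))"
        proof (rule runs_Seq[OF runs_clear_prog[where r = i and c = q and n = n]])
          fix s3 assume 3: "?R s2 i q s3"
          show "runs (clear_prog RQ RI) s3 (48 - 12 - 12 - 12)
            (\<lambda>s'. s' RQ [] = int q \<and> I (Suc q) (s'(RQ := (s' RQ)([] := int (Suc q)))))"
          proof (rule runs_mono[OF runs_clear_prog[where r = q and c = i and n = n]])
            fix s4 assume 4: "?R s3 q i s4"
            have "s4 w = s w" if "w \<notin> {RZ, RCol, RQ}" for w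
              using 1 2 3 4 I that by (simp add: I_def)
            moreover have "s4 RQ [] = int q" using 1 2 3 4 s0 by simp
            moreover have "s4 RZ [int r, int c] =
              (if r \<in> {i, j} \<and> c < Suc q \<or> c \<in> {i, j} \<and> r < Suc q then 0 else s RZ [int r, int c])"
              if "r \<in> {1..n}" "c \<in> {1..n}" for r c
              using 1 2 3 4 I that by (auto simp: I_def less_Suc_eq)
            ultimately show "s4 RQ [] = int q \<and> I (Suc q) (s4(RQ := (s4 RQ)([] := int (Suc q))))"
              using 4 by (simp add: I_def col_sums_def)
          qed (use 1 2 3 s0 q' assms in simp_all)
        qed (use 1 2 s0 q' assms in simp_all)
      qed (use 1 s0 q' assms in simp_all)
    qed (use s0 q' assms in simp_all)
  qed (use assms in \<open>auto simp: I_def col_sums_def\<close>)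
qed

section \<open>The main loop and the quadratic bound\<close>

text \<open>With \<open>k\<close> iterations left, \<open>t = n div 2 - k\<close> are done and
  \<open>RP\<close> is \<open>k - 1\<close>. The slope 77 of a pass adds up 8 and 14 for the
  searches and 55 for clearing.\<close>

lemma runs_main_loop_prog:
  assumes wd: "encmap_well_defined n m" and rep: "represents n s enc_init"
    and digits: "\<forall>p<n div 2. s RA [int p] = int (enc_digit m p)"
  shows "runs main_loop_prog s (n * (77 * n + 36) + 9)
    (\<lambda>s'. represents n s' (enc_state n m (n div 2)))"
proof -
  define I where "I k s' \<longleftrightarrow> k \<le> n div 2 \<and> represents n s' (enc_state n m (n div 2 - k)) \<and>
    s' RP [] = int k - 1 \<and> s' RA = s RA" for k s'
  let ?loop = "For RQ (Lit 1) (Var RN)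
    (clear_prog RQ RJ ;; clear_prog RJ RQ ;; clear_prog RI RQ ;; clear_prog RQ RI)"
  let ?c3 = "Put RX [Var RI, Var RJ] (Lit 1) ;; Put RX [Var RJ, Var RI] (Lit 1) ;;
    ?loop ;; Set RP (Op Sub (Var RP) (Lit 1))"
  have body: "runs (find_col_prog ;; find_row_prog ;; ?c3) s0 (77 * n + 33) (I (k - 1))"
    if I: "I k s0" and k: "k > 0" for k s0
  proof -
    define t where "t = n div 2 - k"
    have t: "t < n div 2" "enc_counter n t = k - 1" "n div 2 - (k - 1) = Suc t"
      using I k by (auto simp: t_def I_def enc_counter_def)
    obtain X Z where XZ: "enc_state n m t = (X, Z)" by fastforce
    define a where "a = enc_digit m (enc_counter n t)"
    define j where "j = enc_col n Z"
    define i where "i = enc_row n Z j a"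
    \<comment> \<open>Well-definedness supplies the witnesses that give the two least elements their
      meaning.\<close>
    obtain j' i' where j': "is_enc_col n Z j'" and i': "is_enc_row n Z j a i'"
      using wd t(1) XZ unfolding encmap_well_defined_def j_def a_def Let_def by (metis snd_conv)
    have jn: "j \<in> {1..n}"
      using LeastI[of "is_enc_col n Z", OF j'] by (simp add: j_def enc_col_def is_enc_col_def)
    have in': "i \<in> {1..n}"
      using LeastI[of "is_enc_row n Z j a", OF i'] by (simp add: i_def enc_row_def is_enc_row_def)
    have rep0: "represents n s0 (X, Z)" using I XZ by (simp add: I_def t_def)
    have P: "s0 RP [] = int (enc_counter n t)" using I k t by (simp add: I_def of_nat_diff)
    have "enc_counter n t < n div 2" using t(1) by (simp add: enc_counter_def)
    then have A: "s0 RA [int (enc_counter n t)] = int a"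
      using I digits by (simp add: I_def a_def)
    show ?thesis
    proof (rule runs_Seq[OF runs_find_col_prog[OF rep0 j' j_def]])
      fix s1 assume s1: "s1 = s0(RJ := (s0 RJ)([] := int j))"
      have rep1: "represents n s1 (X, Z)" using rep0 by (simp add: s1 represents_def col_sums_def)
      have P1: "s1 RP [] = int (enc_counter n t)" and A1: "s1 RA [s1 RP []] = int a"
        using P A by (simp_all add: s1)
      have J1: "s1 RJ [] = int j" by (simp add: s1)
      show "runs (find_row_prog ;; ?c3) s1 (77 * n + 33 - (8 * n + 6)) (I (k - 1))"
      proof (rule runs_Seq[OF runs_find_row_prog[where s = s1 and a = a and j = j and n = n, OF rep1 J1 jn A1 i' i_def]])
        fix s2 assume s2: "s2 RI [] = int i \<and> (\<forall>v. v \<notin> {RI, RSum} \<longrightarrow> s2 v = s1 v)"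
        define s3 where "s3 = s2(RX := (s2 RX)([int i, int j] := 1, [int j, int i] := 1))"
        have s3: "s3 RN [] = int n" "s3 RI [] = int i" "s3 RJ [] = int j" "col_sums n s3"
          "s3 RP [] = int (enc_counter n t)" "s3 RA = s RA"
          using s2 J1 P1 rep1 I by (simp_all add: s3_def represents_def col_sums_def s1 I_def)
        have "runs (?loop ;; Set RP (Op Sub (Var RP) (Lit 1))) s3 (55 * n + 9) (I (k - 1))"
        proof (rule runs_Seq[OF runs_frame[OF runs_clear_loop[where s = s3 and i = i and j = j and n = n, OF s3(1-3) in' jn s3(4)]]])
          fix s4
          assume s4: "(col_sums n s4 \<and> (\<forall>r\<in>{1..n}. \<forall>c\<in>{1..n}.
              s4 RZ [int r, int c] = (if r \<in> {i, j} \<or> c \<in> {i, j} then 0 else s3 RZ [int r, int c]))) \<and>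
            (\<forall>v. v \<notin> writes ?loop \<longrightarrow> s4 v = s3 v)"
          then have frame: "s4 RX = s3 RX" "s4 RN = s3 RN" "s4 RP = s3 RP" "s4 RA = s3 RA"
            by (simp_all add: For_def clear_prog_def)
          have st: "enc_state n m (Suc t) = (\<lambda>r c. if (r, c) = (i, j) \<or> (r, c) = (j, i) then 1 else X r c,
            \<lambda>r c. if r \<in> {i, j} \<or> c \<in> {i, j} then 0 else Z r c)"
            by (simp add: XZ enc_step_def Let_def a_def[symmetric] j_def[symmetric] i_def[symmetric])
          have "represents n s4 (enc_state n m (Suc t))"
            unfolding st represents_def
          proof (intro conjI ballI)
            show "s4 RN [] = int n" "col_sums n s4" using s4 frame s3 by simp_all
            fix r c assume rc: "r \<in> {1..n}" "c \<in> {1..n}"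
            have XZ2: "s2 RX [int r, int c] = X r c" "s2 RZ [int r, int c] = int (Z r c)"
              using rep1 s2 rc by (simp_all add: represents_def)
            have "s4 RX [int r, int c] = (if [int r, int c] = [int j, int i] then 1
                else if [int r, int c] = [int i, int j] then 1 else X r c)"
              by (simp only: frame(1) s3_def fun_upd_apply XZ2 if_True simp_thms)
            moreover have "[int r, int c] = [int j, int i] \<longleftrightarrow> (r, c) = (j, i)"
              "[int r, int c] = [int i, int j] \<longleftrightarrow> (r, c) = (i, j)"
              by simp_all
            \<comment> \<open>Merges the two successive stores into the single disjunction of
              \<open>enc_step\<close>; their order is immaterial because both write 1.\<close>
            moreover have "(if P then 1 else if Q then 1 else x) = (if Q \<or> P then 1 else x)" for P Q and x :: int
              by simp
            ultimately show "s4 RX [int r, int c] =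
              fst (\<lambda>r c. if (r, c) = (i, j) \<or> (r, c) = (j, i) then 1 else X r c,
                \<lambda>r c. if r \<in> {i, j} \<or> c \<in> {i, j} then 0 else Z r c) r c"
              by (simp only: fst_conv)
            have "s4 RZ [int r, int c] = (if r \<in> {i, j} \<or> c \<in> {i, j} then 0 else s3 RZ [int r, int c])"
              using s4 rc by blast
            then show "s4 RZ [int r, int c] =
              int (snd (\<lambda>r c. if (r, c) = (i, j) \<or> (r, c) = (j, i) then 1 else X r c,
                \<lambda>r c. if r \<in> {i, j} \<or> c \<in> {i, j} then 0 else Z r c) r c)"
              unfolding s3_def using XZ2(2) by simp
          qed
          then show "runs (Set RP (Op Sub (Var RP) (Lit 1))) s4 (55 * n + 9 - (55 * n + 5)) (I (k - 1))"
            using I k t s3 frame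
            by (intro runs_Put) (auto simp: I_def represents_def col_sums_def of_nat_diff)
        qed simp
        then show "runs ?c3 s2 (77 * n + 33 - (8 * n + 6) - (14 * n + 10)) (I (k - 1))"
          using s2 J1 by (intro runs_Put_Seq) (simp_all add: s3_def add.commute)
      qed simp
    qed simp
  qed
  show ?thesis
    unfolding main_loop_prog_def
  proof (rule runs_Put_Seq, rule runs_While[where I = I and k = "n div 2" and B = "77 * n + 33"])
    show "I (n div 2) (s(RP := (s RP)(map (\<lambda>e. aval e s) [] :=
        aval (Op Sub (Op Div (Var RN) (Lit 2)) (Lit 1)) s)))"
      using rep by (simp add: I_def represents_def col_sums_def zdiv_int)
    \<comment> \<open>Replacing \<open>n div 2\<close> passes by \<open>n\<close> costs a constant
      factor and keeps the bound polynomial.\<close>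
    have "n div 2 * (77 * n + 36) \<le> n * (77 * n + 36)" by (intro mult_right_mono) auto
    then show "n div 2 * (77 * n + 33 + bcost (Cmp Le (Lit 0) (Var RP))) + bcost (Cmp Le (Lit 0) (Var RP))
      \<le> n * (77 * n + 36) + 9 -
        (1 + (\<Sum>e'\<leftarrow>[]. acost e') + acost (Op Sub (Op Div (Var RN) (Lit 2)) (Lit 1)))"
      by (simp add: add.commute)
  qed (use body in \<open>auto simp: I_def\<close>)
qed

lemma runs_encmap_prog:
  assumes "encmap_well_defined n m" "m > 0" "s RN [] = int n" "s RM [] = int m"
  shows "runs encmap_prog s (107 * n ^ 2 + 104 * n + 44) (\<lambda>s'. output_mat n s' = encmap n m)"
  unfolding encmap_prog_def
proof (rule runs_Seq[OF runs_digits_prog[where s = s and n = n and m = m, OF assms(3,4,2)]])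
  fix s1
  assume s1: "s1 RN [] = int n \<and> (\<forall>p<n div 2. s1 RA [int p] = int (enc_digit m p))"
  let ?T = "107 * n ^ 2 + 104 * n + 44 - (30 * n + 20)"
  show "runs (init_prog ;; main_loop_prog) s1 ?T (\<lambda>s'. output_mat n s' = encmap n m)"
  proof (rule runs_Seq[OF runs_frame[OF runs_init_prog[where n = n]]])
    fix s2
    assume s2: "represents n s2 enc_init \<and> (\<forall>v. v \<notin> writes init_prog \<longrightarrow> s2 v = s1 v)"
    \<comment> \<open>The digits survive initialisation because \<open>init_prog\<close> never
      writes \<open>RA\<close>.\<close>
    then have A: "\<forall>p<n div 2. s2 RA [int p] = int (enc_digit m p)"
      using s1 by (simp add: init_prog_def For_def)
    show "runs main_loop_prog s2 (?T - (15 + n * (30 * n + 38)))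
        (\<lambda>s'. output_mat n s' = encmap n m)"
    proof (rule runs_mono[OF runs_main_loop_prog[where s = s2, OF assms(1) conjunct1[OF s2] A]])
      fix s3 assume rep: "represents n s3 (enc_state n m (n div 2))"
      show "output_mat n s3 = encmap n m"
        unfolding output_mat_def encmap_def
      proof (rule eq_matI)
        fix i j
        assume "i < dim_row (mat n n (\<lambda>(i, j). fst (enc_state n m (n div 2)) (i + 1) (j + 1)))"
          and "j < dim_col (mat n n (\<lambda>(i, j). fst (enc_state n m (n div 2)) (i + 1) (j + 1)))"
        then have "i < n" "j < n" by simp_all
        moreover from this have "i + 1 \<in> {1..n}" "j + 1 \<in> {1..n}" by auto
        then have "s3 RX [int (i + 1), int (j + 1)] = fst (enc_state n m (n div 2)) (i + 1) (j + 1)"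
          using rep unfolding represents_def by blast
        ultimately show "mat n n (\<lambda>(i, j). s3 RX [int i + 1, int j + 1]) $$ (i, j) =
          mat n n (\<lambda>(i, j). fst (enc_state n m (n div 2)) (i + 1) (j + 1)) $$ (i, j)"
          by (simp add: add.commute)
      qed simp_all
    qed (simp add: power2_eq_square algebra_simps)
  qed (use s1 in \<open>simp_all add: power2_eq_square algebra_simps\<close>)
qed simp

text \<open>For \<open>n \<ge> 1\<close> the lower-order terms are absorbed into the square: 255 is
  107 + 104 + 44.\<close>

lemma encmap_time_bound_quadratic: "encmap_time_bound (\<lambda>n. 255 * n ^ 2)"
  unfolding encmap_time_bound_def
proof (intro allI impI)
  fix n m :: nat and s :: "cell memory"
  assume n: "n > 0" "even n" and m: "m \<in> {1..num_inputs n}" and s: "s RN [] = int n" "s RM [] = int m"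
  have "n \<le> n ^ 2" "1 \<le> n ^ 2" using n(1) by (simp_all add: power2_eq_square)
  then have "107 * n ^ 2 + 104 * n + 44 \<le> 255 * n ^ 2" by linarith
  moreover have "m > 0" using m by simp
  note runs_encmap_prog[where s = s and m = m, OF encmap_well_defined_even[OF n(2)] this s]
  ultimately show "\<exists>t s'. exec encmap_prog s t s' \<and> output_mat n s' = encmap n m \<and> t \<le> 255 * n ^ 2"
    unfolding runs_def by (meson order.trans)
qed

theorem mainTheorem5:
  "(\<forall>n. n > 0 \<and> even n \<longrightarrow>
      (\<forall>m \<in> {1..num_inputs n}. encmap_well_defined n m) \<and>
      bij_betw (encmap n) {1..num_inputs n} (pure_involutions n)) \<and>
   (\<exists>T. encmap_time_bound T \<and> (\<lambda>n. real (T n)) \<in> O(\<lambda>n. real n ^ 2))"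
proof (intro conjI allI impI ballI exI)
  show "(\<lambda>n. real (255 * n ^ 2)) \<in> O(\<lambda>n. real n ^ 2)" by simp
qed (use encmap_well_defined_even encmap_bij_betw encmap_time_bound_quadratic in auto)

end
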